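(* Let $0<q<1$ and let $a,b,c,d$ be (generic, nonzero) complex parameters, with dual parameters $\tilde a,\tilde b,\tilde c,\tilde d$ and dual variables $\tilde z,\tilde\gamma$ defined by $$\tilde a=\sqrt{\frac{q^3}{abcd}},\quad \tilde b=\frac{q^2}{\tilde a ab},\quad \tilde c=\frac{q^2}{\tilde a ac},\quad \tilde d=\frac{q^2}{\tilde a ad},\qquad \tilde z=\frac{q^{\gamma+1}}{\tilde a},\quad \tilde\gamma=\frac{\log(az)}{\log(q)}-1 .$$ Let $\bar R_\gamma(a,b,c,d;z)=\bar r(a,b,c,d;z)\,r_\gamma(a,b,c,d;z)$ and $\bar S_\gamma(a,b,c,d;z)=\bar s(a,b,c,d;z)\,s_\gamma(a,b,c,d;z)$, where $$\bar r(a,b,c,d;z)=bcd\,z^{2-\log(abcd)/\log(q)}\,\frac{(bc,bd,cd,qz/a,qz/b,qz/c,qz/d;q)_\infty}{(bz,cz,dz,bcd/z;q)_\infty},\qquad \bar s(a,b,c,d;z)=\frac{bcdz}{(bz,cz,dz;q)_\infty},$$ and $r_\gamma,s_\gamma$ are as defined in the context. Then the duality relations $$\bar R_\gamma(a,b,c,d;z)=\bar R_{\tilde\gamma}(\tilde a,\tilde b,\tilde c,\tilde d;\tilde z)\qquad\text{and}\qquad \bar S_\gamma(a,b,c,d;z)=\bar S_{\tilde\gamma}(\tilde a,\tilde b,\tilde c,\tilde d;\tilde z)$$ hold.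
   Context: Notation: $(x;q)_\infty=\prod_{i\ge0}(1-xq^i)$, $(x;q)_k=(x;q)_\infty/(xq^k;q)_\infty$, $(x_1,\dots,x_r;q)_k=\prod_i(x_i;q)_k$. The very-well-poised series is $${}_8W_7(\alpha;a_1,a_2,a_3,a_4,a_5;q,x)=\sum_{k\ge0}\frac{(\alpha,q\alpha^{1/2},-q\alpha^{1/2},a_1,\dots,a_5;q)_k}{(q,\alpha^{1/2},-\alpha^{1/2},q\alpha/a_1,\dots,q\alpha/a_5;q)_k}x^k,$$ understood as the sum of the series where it converges and by analytic continuation otherwise. $$r_\gamma(a,b,c,d;z)=\frac{(abq^\gamma,acq^\gamma,adq^\gamma,bcdq^\gamma/z;q)_\infty}{(bcq^\gamma,bdq^\gamma,cdq^\gamma,azq^\gamma;q)_\infty}\Big(\frac az\Big)^\gamma\,{}_8W_7\big(bcd/qz;\,b/z,c/z,d/z,abcdq^{\gamma-1},q^{-\gamma};q,qz/a\big),$$ $$s_\gamma(a,b,c,d;z)=\frac{(abcdq^{2\gamma},bzq^{\gamma+1},czq^{\gamma+1},dzq^{\gamma+1},bcdzq^\gamma;q)_\infty}{(bcq^\gamma,bdq^\gamma,cdq^\gamma,q^{\gamma+1},bcdzq^{2\gamma+1};q)_\infty}(az)^\gamma\,{}_8W_7\big(bcdzq^{2\gamma};\,bcq^\gamma,bdq^\gamma,cdq^\gamma,q^{\gamma+1},zq/a;q,az\big).$$ Complex powers are taken with compatible logarithms: logarithms of $a,b,c,d,z$ are fixed, and the logarithms of products and of the dual quantities are the corresponding linear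 combinations (e.g. $\log\tilde a=\tfrac12(3\log q-\log a-\log b-\log c-\log d)$, $\log\tilde z=(\gamma+1)\log q-\log\tilde a$, $\log(az)=\log a+\log z$). *)

theory Defs
  imports "HOL-Analysis.Analysis"
begin

definition qpoch_inf :: "real \<Rightarrow> complex \<Rightarrow> complex" where
  "qpoch_inf q x = (\<Prod>i. 1 - x * of_real q ^ i)"

(* The quotient (x;q)_inf / (x q^k;q)_inf is 0/0 when x q^n = 1 for some n >= k (as happens for
   terminating series), so for natural k the finite product is used; qpoch_inf_split below shows
   that it is the same thing. *)
definition qpoch :: "real \<Rightarrow> complex \<Rightarrow> nat \<Rightarrow> complex" where
  "qpoch q x k = (\<Prod>i<k. 1 - x * of_real q ^ i)"

definition qpochs_inf :: "real \<Rightarrow> complex list \<Rightarrow> complex" where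
  "qpochs_inf q xs = (\<Prod>x\<leftarrow>xs. qpoch_inf q x)"

definition qpochs :: "real \<Rightarrow> complex list \<Rightarrow> nat \<Rightarrow> complex" where
  "qpochs q xs k = (\<Prod>x\<leftarrow>xs. qpoch q x k)"

lemma qpoch_inf_rec:
  assumes "0 < q" "q < 1"
  shows "qpoch_inf q x = (1 - x) * qpoch_inf q (x * of_real q)"
proof -
  have conv: "convergent_prod (\<lambda>i. 1 - y * complex_of_real q ^ i)" for y
  proof -
    have "summable (\<lambda>i. norm ((1 - y * complex_of_real q ^ i) - 1))"
      using assms by (simp add: norm_mult norm_power summable_mult summable_geometric)
    thus ?thesis
      by (intro abs_convergent_prod_imp_convergent_prod summable_imp_abs_convergent_prod)
  qed
  have "(\<lambda>i. 1 - x * of_real q ^ Suc i) has_prod qpoch_inf q (x * of_real q)"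
    using convergent_prod_has_prod[OF conv[of "x * of_real q"]]
    by (simp add: qpoch_inf_def mult_ac)
  hence "(\<lambda>i. 1 - x * of_real q ^ i) has_prod (qpoch_inf q (x * of_real q) * (1 - x * of_real q ^ 0))"
    by (rule has_prod_Suc_imp)
  from has_prod_unique[OF this] show ?thesis by (simp add: qpoch_inf_def mult.commute)
qed

lemma qpoch_inf_split:
  assumes "0 < q" "q < 1"
  shows "qpoch_inf q x = qpoch q x k * qpoch_inf q (x * of_real q ^ k)"
proof (induction k)
  case 0
  show ?case by (simp add: qpoch_def)
next
  case (Suc k)
  thus ?case using qpoch_inf_rec[OF assms, of "x * of_real q ^ k"]
    by (simp add: qpoch_def mult_ac)
qed

(* None of the products (x;q)_inf, x in xs, vanishes; equivalently no (x;q)_k vanishes. *)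
definition qpochs_nonzero :: "real \<Rightarrow> complex list \<Rightarrow> bool" where
  "qpochs_nonzero q xs \<longleftrightarrow> (\<forall>x\<in>set xs. \<forall>i::nat. x * of_real q ^ i \<noteq> 1)"


subsection \<open>The very-well-poised series\<close>

(* The coefficient does not depend on the choice of the square root of al. *)
definition W87_coeff ::
  "real \<Rightarrow> complex \<Rightarrow> complex \<Rightarrow> complex \<Rightarrow> complex \<Rightarrow> complex \<Rightarrow> complex \<Rightarrow> nat \<Rightarrow> complex" where
  "W87_coeff q al a1 a2 a3 a4 a5 k =
     qpochs q [al, q * csqrt al, - (q * csqrt al), a1, a2, a3, a4, a5] k /
     qpochs q [q, csqrt al, - csqrt al, q * al / a1, q * al / a2, q * al / a3, q * al / a4, q * al / a5] k"

(* Outside the region of convergence: analytic continuation in the argument x, the other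
   parameters being fixed. As a function of x the continuation is single-valued, its only possible
   singularities being the points q^(-i), i = 0, 1, 2, ...; the set below is the complement of these
   points, which is open and connected, so that the value is unique. *)
definition W87 ::
  "real \<Rightarrow> complex \<Rightarrow> complex \<Rightarrow> complex \<Rightarrow> complex \<Rightarrow> complex \<Rightarrow> complex \<Rightarrow> complex \<Rightarrow> complex" where
  "W87 q al a1 a2 a3 a4 a5 x =
     (if summable (\<lambda>k. W87_coeff q al a1 a2 a3 a4 a5 k * x ^ k)
      then (\<Sum>k. W87_coeff q al a1 a2 a3 a4 a5 k * x ^ k)
      else (THE y. \<exists>f. f holomorphic_on {w. \<forall>i::nat. w * of_real q ^ i \<noteq> 1} \<and>
              (\<forall>w\<in>ball 0 1. (\<lambda>k. W87_coeff q al a1 a2 a3 a4 a5 k * w ^ k) sums f w) \<and>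
              y = f x))"

(* No denominator in a coefficient vanishes, and x is not one of the points q^(-i). *)
definition W87_defined ::
  "real \<Rightarrow> complex \<Rightarrow> complex \<Rightarrow> complex \<Rightarrow> complex \<Rightarrow> complex \<Rightarrow> complex \<Rightarrow> complex \<Rightarrow> bool" where
  "W87_defined q al a1 a2 a3 a4 a5 x \<longleftrightarrow>
     qpochs_nonzero q
       [csqrt al, - csqrt al, q * al / a1, q * al / a2, q * al / a3, q * al / a4, q * al / a5, x]"


subsection \<open>The functions r, s and their normalizations\<close>

(* The functions below involve complex powers of a, b, c, d, z, so they take as arguments
   logarithms la, lb, lc, ld, lz of these (nonzero) parameters, which may be on any branch.
   For the base q > 0, q powr g = exp (g * ln q). *)

definition r_fun ::
  "real \<Rightarrow> complex \<Rightarrow> complex \<Rightarrow> complex \<Rightarrow> complex \<Rightarrow> complex \<Rightarrow> complex \<Rightarrow> complex" where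
  "r_fun q g la lb lc ld lz =
     (let a = exp la; b = exp lb; c = exp lc; d = exp ld; z = exp lz; qg = of_real q powr g in
      qpochs_inf q [a * b * qg, a * c * qg, a * d * qg, b * c * d * qg / z] /
      qpochs_inf q [b * c * qg, b * d * qg, c * d * qg, a * z * qg] *
      exp (g * (la - lz)) *
      W87 q (b * c * d / (q * z)) (b / z) (c / z) (d / z)
        (a * b * c * d * of_real q powr (g - 1)) (of_real q powr (- g)) (q * z / a))"

definition s_fun ::
  "real \<Rightarrow> complex \<Rightarrow> complex \<Rightarrow> complex \<Rightarrow> complex \<Rightarrow> complex \<Rightarrow> complex \<Rightarrow> complex" where
  "s_fun q g la lb lc ld lz =
     (let a = exp la; b = exp lb; c = exp lc; d = exp ld; z = exp lz;
          qg = of_real q powr g; qg1 = of_real q powr (g + 1) in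
      qpochs_inf q [a * b * c * d * of_real q powr (2 * g), b * z * qg1, c * z * qg1, d * z * qg1,
                    b * c * d * z * qg] /
      qpochs_inf q [b * c * qg, b * d * qg, c * d * qg, qg1,
                    b * c * d * z * of_real q powr (2 * g + 1)] *
      exp (g * (la + lz)) *
      W87 q (b * c * d * z * of_real q powr (2 * g)) (b * c * qg) (b * d * qg) (c * d * qg) qg1
        (z * q / a) (a * z))"

definition r_bar ::
  "real \<Rightarrow> complex \<Rightarrow> complex \<Rightarrow> complex \<Rightarrow> complex \<Rightarrow> complex \<Rightarrow> complex" where
  "r_bar q la lb lc ld lz =
     (let a = exp la; b = exp lb; c = exp lc; d = exp ld; z = exp lz in
      b * c * d * exp (lz * (2 - (la + lb + lc + ld) / of_real (ln q))) *
      (qpochs_inf q [b * c, b * d, c * d, q * z / a, q * z / b, q * z / c, q * z / d] /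
       qpochs_inf q [b * z, c * z, d * z, b * c * d / z]))"

definition s_bar ::
  "real \<Rightarrow> complex \<Rightarrow> complex \<Rightarrow> complex \<Rightarrow> complex \<Rightarrow> complex \<Rightarrow> complex" where
  "s_bar q la lb lc ld lz =
     (let b = exp lb; c = exp lc; d = exp ld; z = exp lz in
      b * c * d * z / qpochs_inf q [b * z, c * z, d * z])"

definition R_bar ::
  "real \<Rightarrow> complex \<Rightarrow> complex \<Rightarrow> complex \<Rightarrow> complex \<Rightarrow> complex \<Rightarrow> complex \<Rightarrow> complex" where
  "R_bar q g la lb lc ld lz = r_bar q la lb lc ld lz * r_fun q g la lb lc ld lz"

definition S_bar ::
  "real \<Rightarrow> complex \<Rightarrow> complex \<Rightarrow> complex \<Rightarrow> complex \<Rightarrow> complex \<Rightarrow> complex \<Rightarrow> complex" where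
  "S_bar q g la lb lc ld lz = s_bar q la lb lc ld lz * s_fun q g la lb lc ld lz"


subsection \<open>Genericity\<close>

(* Genericity means that the defining formula makes sense: all infinite products in denominators
   are nonzero and the very-well-poised series is defined. *)

definition R_generic ::
  "real \<Rightarrow> complex \<Rightarrow> complex \<Rightarrow> complex \<Rightarrow> complex \<Rightarrow> complex \<Rightarrow> complex \<Rightarrow> bool" where
  "R_generic q g la lb lc ld lz \<longleftrightarrow>
     (let a = exp la; b = exp lb; c = exp lc; d = exp ld; z = exp lz; qg = of_real q powr g in
      qpochs_nonzero q [b * z, c * z, d * z, b * c * d / z] \<and>
      qpochs_nonzero q [b * c * qg, b * d * qg, c * d * qg, a * z * qg] \<and>
      W87_defined q (b * c * d / (q * z)) (b / z) (c / z) (d / z)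
        (a * b * c * d * of_real q powr (g - 1)) (of_real q powr (- g)) (q * z / a))"

definition S_generic ::
  "real \<Rightarrow> complex \<Rightarrow> complex \<Rightarrow> complex \<Rightarrow> complex \<Rightarrow> complex \<Rightarrow> complex \<Rightarrow> bool" where
  "S_generic q g la lb lc ld lz \<longleftrightarrow>
     (let a = exp la; b = exp lb; c = exp lc; d = exp ld; z = exp lz;
          qg = of_real q powr g; qg1 = of_real q powr (g + 1) in
      qpochs_nonzero q [b * z, c * z, d * z] \<and>
      qpochs_nonzero q [b * c * qg, b * d * qg, c * d * qg, qg1,
                        b * c * d * z * of_real q powr (2 * g + 1)] \<and>
      W87_defined q (b * c * d * z * of_real q powr (2 * g)) (b * c * qg) (b * d * qg) (c * d * qg)
        qg1 (z * q / a) (a * z))"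


subsection \<open>Logarithms of the dual parameters\<close>

definition dual_log_a :: "real \<Rightarrow> complex \<Rightarrow> complex \<Rightarrow> complex \<Rightarrow> complex \<Rightarrow> complex" where
  "dual_log_a q la lb lc ld = (3 * of_real (ln q) - la - lb - lc - ld) / 2"

(* The logarithm of q^2 / (a~ a x), where x is b, c or d; la' is the logarithm of a~. *)
definition dual_log :: "real \<Rightarrow> complex \<Rightarrow> complex \<Rightarrow> complex \<Rightarrow> complex" where
  "dual_log q la' la lx = 2 * of_real (ln q) - la' - la - lx"

definition dual_log_z :: "real \<Rightarrow> complex \<Rightarrow> complex \<Rightarrow> complex" where
  "dual_log_z q la' g = (g + 1) * of_real (ln q) - la'"

definition dual_gamma :: "real \<Rightarrow> complex \<Rightarrow> complex \<Rightarrow> complex" where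
  "dual_gamma q la lz = (la + lz) / of_real (ln q) - 1"

lemma exp_of_real_ln: "q > 0 \<Longrightarrow> exp (complex_of_real (ln q)) = of_real q"
  by (metis exp_ln exp_of_real)

lemma exp_dual_log_a:
  assumes "q > 0"
  shows "exp (dual_log_a q la lb lc ld) ^ 2 = of_real q ^ 3 / (exp la * exp lb * exp lc * exp ld)"
proof -
  have "exp (dual_log_a q la lb lc ld) ^ 2 = exp (2 * dual_log_a q la lb lc ld)"
    by (rule exp_double [symmetric])
  also have "2 * dual_log_a q la lb lc ld = of_nat 3 * of_real (ln q) - la - lb - lc - ld"
    unfolding dual_log_a_def by simp
  also have "exp \<dots> = exp (of_real (ln q)) ^ 3 / (exp la * exp lb * exp lc * exp ld)"
    by (simp only: exp_diff exp_of_nat_mult divide_divide_eq_left mult.assoc)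
  finally show ?thesis by (simp only: exp_of_real_ln [OF assms])
qed

lemma exp_dual_log:
  assumes "q > 0"
  shows "exp (dual_log q la' la lx) = of_real q ^ 2 / (exp la' * exp la * exp lx)"
  unfolding dual_log_def
  by (simp only: exp_diff exp_double exp_of_real_ln [OF assms] divide_divide_eq_left mult.assoc)

lemma exp_dual_log_z:
  assumes "q > 0"
  shows "exp (dual_log_z q la' g) = of_real q powr (g + 1) / exp la'"
  using assms by (simp add: dual_log_z_def exp_diff powr_def Ln_of_real)

end

(*
  Both relations are instances of the two-term transformation of nonterminating very-well-poised 8W7
  series (Gasper and Rahman, (III.24)) in which the argument of the second series is a parameter of the
  first one; the remaining infinite products and the powers of z then match factor by factor.

  (III.24) is (III.23) applied twice. For a last parameter f = q^(-n), (III.23) says that the right-hand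
  side of Watson's transformation, itself the Bailey lemma applied twice to the unit Bailey pair, has a
  hidden symmetry. Both sides are analytic in 1/f near 0, where the points q^n accumulate, so the
  identity theorem gives (III.23) for all f. To apply it beyond the region of convergence, the series
  is continued by the recurrence that its term ratio, a rational function of q^k, imposes on its
  values at the arguments x, xq, xq^2, ...
*)

theory Submission
  imports Defs "HOL-Complex_Analysis.Complex_Analysis"
begin

text \<open>Duality exchanges the argument of each series with one of its parameters:
  \<open>a z\<close> with \<open>q^(gamma+1)\<close> in S, and \<open>q z/a\<close> with
  \<open>a b c d q^(gamma-1)\<close> in R. These are the instances of the two-term transformation
  that are needed. Two obstacles shape the proof. The definition of \<open>W87\<close> continues the
  series in its argument alone, whereas the identity theorem in the last parameter and the
  deformation below require holomorphy in the other parameters too. A continuation built from a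
  recurrence in the coefficients of two polynomials depends holomorphically on all of them at once,
  and uniqueness identifies it with \<open>W87\<close>. Genericity, on the other hand, is a
  condition on the two outer series only. The series between the two applications of (III.23) may
  have vanishing denominators or a forbidden argument, so the parameters are deformed along a curve
  that keeps the outer series regular near its base point and meets the degenerate cases only
  countably often.\<close>

lemma qpoch_0 [simp]: "qpoch q x 0 = 1"
  by (simp add: qpoch_def)

lemma qpoch_Suc: "qpoch q x (Suc k) = qpoch q x k * (1 - x * of_real q ^ k)"
  by (simp add: qpoch_def)

lemma qpoch_add: "qpoch q x (m + k) = qpoch q x m * qpoch q (x * of_real q ^ m) k"
  by (induction k) (simp_all add: qpoch_Suc power_add mult_ac)

text \<open>Regular points are the nonzeros of the infinite product
  (\<open>qpoch_inf_eq_0_iff\<close>), so one predicate expresses both that the coefficients of a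
  series have nonzero denominators and that an infinite product may be cancelled.\<close>

definition qregular :: "real \<Rightarrow> complex \<Rightarrow> bool" where
  "qregular q x \<longleftrightarrow> (\<forall>i::nat. x * of_real q ^ i \<noteq> 1)"

lemma qregularD: "qregular q x \<Longrightarrow> 1 - x * of_real q ^ i \<noteq> 0"
  by (auto simp: qregular_def)

lemma qregular_mult_power: "qregular q x \<Longrightarrow> qregular q (x * of_real q ^ m)"
  unfolding qregular_def by (metis mult.assoc power_add)

lemma qpoch_nonzero: "qregular q x \<Longrightarrow> qpoch q x k \<noteq> 0"
  unfolding qpoch_def using qregularD by auto

lemma qregular_small:
  assumes "0 < q" "q < 1" "norm x < 1"
  shows "qregular q x"
  unfolding qregular_def
proof
  fix i :: nat
  have "norm (x * of_real q ^ i) \<le> norm x * 1"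
    unfolding norm_mult norm_power using assms
    by (intro mult_left_mono power_le_one) auto
  thus "x * of_real q ^ i \<noteq> 1" using assms by auto
qed

lemma qregular_base: "0 < q \<Longrightarrow> q < 1 \<Longrightarrow> qregular q (of_real q)"
  by (rule qregular_small) auto

subsection \<open>The Bailey lemma\<close>

text \<open>The q-Pfaff-Saalschuetz sum of a balanced terminating 3phi2 with lower parameter
  \<open>C = u A B\<close>. The factors with parameters \<open>q^(-M)\<close> and
  \<open>A B q^(1-M) / C\<close> are reversed into factors of length \<open>M - i\<close>, which
  leaves \<open>qpoch q u\<close> in numerators only.\<close>

lemma q_Saalschuetz:
  fixes A B u :: complex
  assumes q: "0 < q" "q < 1" and C: "qregular q (u * A * B)"
  shows "(\<Sum>i\<le>M. qpoch q A i * qpoch q B i * qpoch q u (M - i) * u ^ i /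
           (qpoch q q (M - i) * qpoch q q i * qpoch q (u * A * B) i)) =
         qpoch q (u * A) M * qpoch q (u * B) M / (qpoch q q M * qpoch q (u * A * B) M)"
proof (induction M)
  case 0
  show ?case by simp
next
  case (Suc M)
  let ?Q = "complex_of_real q"
  define s where "s M i = qpoch q A i * qpoch q B i * qpoch q u (M - i) * u ^ i /
           (qpoch q q (M - i) * qpoch q q i * qpoch q (u * A * B) i)" for M i
  \<comment> \<open>The partner of \<open>s\<close> in a q-Zeilberger telescoping relation.\<close>
  define G where "G i = (case i of 0 \<Rightarrow> 0 | Suc j \<Rightarrow> - (?Q ^ (M - j)) * qpoch q A i * qpoch q B i *
     qpoch q u (M - j) * u ^ i / (qpoch q q (M - j) * qpoch q q j * qpoch q (u * A * B) j))" for i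
  note nz = qpoch_nonzero[OF qregular_base[OF q]] qpoch_nonzero[OF C]
    qregularD[OF qregular_base[OF q]] qregularD[OF C]
  have nz': "1 - ?Q * ?Q ^ i \<noteq> 0" for i using qregularD[OF qregular_base[OF q]] .
  have step: "s (Suc M) i * ((1 - ?Q * ?Q ^ M) * (1 - u * A * B * ?Q ^ M)) - 
      (1 - u * A * ?Q ^ M) * (1 - u * B * ?Q ^ M) * s M i = G (Suc i) - G i" if "i < Suc M" for i
  proof -
    have "i \<le> M" using that by simp
    then obtain p where p: "M = i + p" using le_Suc_ex by blast
    define b I P where "b = s M i" and "I = ?Q ^ i" and "P = ?Q ^ p"
    have PI: "?Q ^ M = I * P" by (simp add: I_def P_def p power_add)
    have s1: "s (Suc M) i = b * ((1 - u * P) / (1 - ?Q * P))"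
      by (simp add: b_def s_def p P_def qpoch_Suc Suc_diff_le mult_ac)
    have g1: "G (Suc i) = - P * b * u * ((1 - A * I) * (1 - B * I))"
      by (simp add: b_def s_def G_def p P_def I_def qpoch_Suc)
    have g2: "G i = - P * (1 - I) * (?Q - u * A * B * I) * ((1 - u * P) / (1 - ?Q * P)) * b"
    proof (cases i)
      case 0
      thus ?thesis by (simp add: G_def I_def)
    next
      case (Suc j)
      have e: "s M i = qpoch q A i * qpoch q B i * qpoch q u p * u ^ i / (qpoch q q p *
          (qpoch q q j * (1 - I)) * (qpoch q (u * A * B) j * (1 - u * A * B * ?Q ^ j)))"
        by (simp add: s_def p Suc qpoch_Suc I_def)
      have Mj: "M - j = Suc p" by (simp add: p Suc)
      have Gi: "G i = - (P * ?Q) * qpoch q A i * qpoch q B i * (qpoch q u p * (1 - u * P)) * u ^ i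
           / (qpoch q q p * (1 - ?Q * P) * qpoch q q j * qpoch q (u * A * B) j)"
        unfolding G_def Mj P_def using Suc Mj by (simp add: qpoch_Suc mult_ac)
      have QI: "?Q - u * A * B * I = ?Q * (1 - u * A * B * ?Q ^ j)"
        by (simp add: I_def Suc algebra_simps)
      have n: "1 - I \<noteq> 0" "1 - u * A * B * ?Q ^ j \<noteq> 0"
        using nz'[of j] nz by (auto simp: I_def Suc)
      show ?thesis unfolding b_def e Gi QI using n by (simp add: mult_ac)
    qed
    have n: "1 - ?Q * P \<noteq> 0" using nz'[of p] by (simp add: P_def)
    \<comment> \<open>The telescoping relation, divided by the common factor \<open>b\<close> and
      cleared of the denominator \<open>1 - ?Q * P\<close>, is a polynomial identity in
      \<open>u\<close>, \<open>A\<close>, \<open>B\<close>, \<open>I\<close>, \<open>P\<close> and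
      \<open>?Q\<close>.\<close>
    have alg: "(1 - u * P) * (1 - ?Q * (I * P)) * (1 - u * A * B * (I * P)) - 
        (1 - u * A * (I * P)) * (1 - u * B * (I * P)) * (1 - ?Q * P) =
        - P * u * (1 - A * I) * (1 - B * I) * (1 - ?Q * P) + 
          P * (1 - I) * (?Q - u * A * B * I) * (1 - u * P)"
      by (simp add: algebra_simps)
    define V where "V = 1 / (1 - ?Q * P)"
    have V: "(1 - ?Q * P) * V = 1" "(1 - u * P) / (1 - ?Q * P) = (1 - u * P) * V"
      using n by (simp_all add: V_def)
    show ?thesis
      unfolding PI s1 g1 g2 b_def[symmetric] V(2)
      using alg V(1) by algebra
  qed
  have "(\<Sum>i\<le>Suc M. s (Suc M) i) * ((1 - ?Q * ?Q ^ M) * (1 - u * A * B * ?Q ^ M)) =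
        (\<Sum>i<Suc M. s (Suc M) i * ((1 - ?Q * ?Q ^ M) * (1 - u * A * B * ?Q ^ M))) + 
         s (Suc M) (Suc M) * ((1 - ?Q * ?Q ^ M) * (1 - u * A * B * ?Q ^ M))"
    by (simp add: sum_distrib_right lessThan_Suc_atMost distrib_right)
  \<comment> \<open>The term of index \<open>Suc M\<close> has no partner in the sum for
    \<open>M\<close>, so \<open>step\<close> does not cover it. It cancels the upper boundary of the
    telescoped sum.\<close>
  also have "s (Suc M) (Suc M) * ((1 - ?Q * ?Q ^ M) * (1 - u * A * B * ?Q ^ M)) = - G (Suc M)"
    using nz nz'[of M] by (simp add: s_def G_def qpoch_Suc)
  also have "(\<Sum>i<Suc M. s (Suc M) i * ((1 - ?Q * ?Q ^ M) * (1 - u * A * B * ?Q ^ M))) =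
     (\<Sum>i<Suc M. (1 - u * A * ?Q ^ M) * (1 - u * B * ?Q ^ M) * s M i + (G (Suc i) - G i))"
    by (intro sum.cong refl) (use step in \<open>simp add: algebra_simps\<close>)
  also have "\<dots> = (1 - u * A * ?Q ^ M) * (1 - u * B * ?Q ^ M) * (\<Sum>i\<le>M. s M i) + (G (Suc M) - G 0)"
    by (subst sum.distrib, subst sum_lessThan_telescope)
       (simp add: sum_distrib_left lessThan_Suc_atMost)
  also have "G 0 = 0" by (simp add: G_def)
  finally have "(\<Sum>i\<le>Suc M. s (Suc M) i) * ((1 - ?Q * ?Q ^ M) * (1 - u * A * B * ?Q ^ M)) =
     (1 - u * A * ?Q ^ M) * (1 - u * B * ?Q ^ M) * (\<Sum>i\<le>M. s M i)"
    by simp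
  also have "(\<Sum>i\<le>M. s M i) = qpoch q (u * A) M * qpoch q (u * B) M / (qpoch q q M * qpoch q (u * A * B) M)"
    using Suc unfolding s_def .
  finally have "(\<Sum>i\<le>Suc M. s (Suc M) i) =
      (1 - u * A * ?Q ^ M) * (1 - u * B * ?Q ^ M) *
      (qpoch q (u * A) M * qpoch q (u * B) M / (qpoch q q M * qpoch q (u * A * B) M)) /
      ((1 - ?Q * ?Q ^ M) * (1 - u * A * B * ?Q ^ M))"
    using nz nz'[of M] by (subst eq_divide_eq) simp
  thus ?case
    unfolding s_def[symmetric] qpoch_Suc by (simp only: times_divide_eq_left times_divide_eq_right divide_divide_eq_left mult_ac)
qed

lemma sum_triangle_swap:
  fixes g :: "nat \<Rightarrow> nat \<Rightarrow> 'a::comm_monoid_add"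
  shows "(\<Sum>j\<le>n. \<Sum>r\<le>j. g j r) = (\<Sum>r\<le>n. \<Sum>i\<le>n - r. g (r + i) r)"
  unfolding sum.Sigma[OF finite_atMost ballI[OF finite_atMost]]
  by (rule sum.reindex_bij_witness[where i = "\<lambda>(r, i). (r + i, r)" and j = "\<lambda>(j, r). (r, j - r)"]) auto

text \<open>The relation between the two components of a Bailey pair relative to \<open>a\<close>,
  taken as an operator that produces the second component from the first.\<close>

definition bailey_beta :: "real \<Rightarrow> complex \<Rightarrow> (nat \<Rightarrow> complex) \<Rightarrow> nat \<Rightarrow> complex" where
  "bailey_beta q a \<alpha> n = (\<Sum>r\<le>n. \<alpha> r / (qpoch q q (n - r) * qpoch q (a * q) (n + r)))"

text \<open>Since \<open>u = aq/xy\<close>, the parameters \<open>u * x\<close> and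
  \<open>u * y\<close> are the usual \<open>aq/y\<close> and \<open>aq/x\<close>. Once the
  summations are exchanged, the inner sum over \<open>j = r + i\<close> is a q-Saalschuetz sum with
  \<open>A = x q^r\<close> and \<open>B = y q^r\<close>; its lower parameter
  \<open>u A B = a q^(2r+1)\<close> continues the factor
  \<open>qpoch q (a * q) (2 * r)\<close>.\<close>

lemma bailey_lemma:
  fixes a x y u :: complex and \<alpha> :: "nat \<Rightarrow> complex"
  assumes q: "0 < q" "q < 1" and aq: "qregular q (a * q)"
    and ux: "qregular q (u * x)" and uy: "qregular q (u * y)"
    and u: "u * x * y = a * q"
  shows "(\<Sum>j\<le>n. qpoch q x j * qpoch q y j * qpoch q u (n - j) * u ^ j / qpoch q q (n - j) *
            bailey_beta q a \<alpha> j) =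
         qpoch q (u * x) n * qpoch q (u * y) n *
         bailey_beta q a (\<lambda>r. qpoch q x r * qpoch q y r * u ^ r /
            (qpoch q (u * x) r * qpoch q (u * y) r) * \<alpha> r) n"
proof -
  let ?Q = "complex_of_real q"
  note nz = qpoch_nonzero[OF qregular_base[OF q]] qpoch_nonzero[OF aq] qpoch_nonzero[OF ux] qpoch_nonzero[OF uy]
  have "(\<Sum>j\<le>n. qpoch q x j * qpoch q y j * qpoch q u (n - j) * u ^ j / qpoch q q (n - j) *
            bailey_beta q a \<alpha> j) =
        (\<Sum>j\<le>n. \<Sum>r\<le>j. qpoch q x j * qpoch q y j * qpoch q u (n - j) * u ^ j / qpoch q q (n - j) *
            (\<alpha> r / (qpoch q q (j - r) * qpoch q (a * q) (j + r))))"
    by (simp add: bailey_beta_def sum_distrib_left)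
  also have "\<dots> = (\<Sum>r\<le>n. \<Sum>i\<le>n - r. qpoch q x (r + i) * qpoch q y (r + i) * qpoch q u (n - (r + i)) *
             u ^ (r + i) / qpoch q q (n - (r + i)) *
            (\<alpha> r / (qpoch q q (r + i - r) * qpoch q (a * q) (r + i + r))))"
    by (rule sum_triangle_swap)
  also have "\<dots> = (\<Sum>r\<le>n. qpoch q (u * x) n * qpoch q (u * y) n *
            ((qpoch q x r * qpoch q y r * u ^ r / (qpoch q (u * x) r * qpoch q (u * y) r) * \<alpha> r) /
              (qpoch q q (n - r) * qpoch q (a * q) (n + r))))"
  proof (rule sum.cong [OF refl])
    fix r assume "r \<in> {..n}"
    then obtain M where M: "n = r + M" by (metis atMost_iff le_Suc_ex)
    define X Y where "X = x * ?Q ^ r" and "Y = y * ?Q ^ r"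
    have XY: "u * X * Y = a * ?Q * ?Q ^ (2 * r)"
    proof -
      have "u * X * Y = (u * x * y) * (?Q ^ r * ?Q ^ r)" by (simp add: X_def Y_def)
      thus ?thesis unfolding u by (simp add: mult_2 power_add)
    qed
    have reg: "qregular q (u * X * Y)"
      unfolding XY by (rule qregular_mult_power[OF aq])
    have "(\<Sum>i\<le>M. qpoch q x (r + i) * qpoch q y (r + i) * qpoch q u (n - (r + i)) *
             u ^ (r + i) / qpoch q q (n - (r + i)) *
            (\<alpha> r / (qpoch q q (r + i - r) * qpoch q (a * q) (r + i + r)))) =
        qpoch q x r * qpoch q y r * u ^ r * \<alpha> r / qpoch q (a * q) (2 * r) *
        (\<Sum>i\<le>M. qpoch q X i * qpoch q Y i * qpoch q u (M - i) * u ^ i /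
           (qpoch q q (M - i) * qpoch q q i * qpoch q (u * X * Y) i))"
      unfolding sum_distrib_left
    proof (rule sum.cong [OF refl])
      fix i assume "i \<in> {..M}"
      have e: "qpoch q (a * q) (r + i + r) = qpoch q (a * q) (2 * r) * qpoch q (u * X * Y) i"
        unfolding XY qpoch_add[symmetric] by (simp add: mult_2 add_ac)
      show "qpoch q x (r + i) * qpoch q y (r + i) * qpoch q u (n - (r + i)) *
             u ^ (r + i) / qpoch q q (n - (r + i)) *
            (\<alpha> r / (qpoch q q (r + i - r) * qpoch q (a * q) (r + i + r))) = 
          qpoch q x r * qpoch q y r * u ^ r * \<alpha> r / qpoch q (a * q) (2 * r) *
         (qpoch q X i * qpoch q Y i * qpoch q u (M - i) * u ^ i /
           (qpoch q q (M - i) * qpoch q q i * qpoch q (u * X * Y) i))"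
        unfolding e qpoch_add[of q x] qpoch_add[of q y] M X_def Y_def power_add by (simp add: mult_ac)
    qed
    also have "\<dots> = qpoch q x r * qpoch q y r * u ^ r * \<alpha> r / qpoch q (a * q) (2 * r) *
        (qpoch q (u * X) M * qpoch q (u * Y) M / (qpoch q q M * qpoch q (u * X * Y) M))"
      by (subst q_Saalschuetz[OF q reg]) simp
    also have "qpoch q (u * X) M = qpoch q (u * x) n / qpoch q (u * x) r"
      using nz by (simp add: M X_def qpoch_add mult.assoc)
    also have "qpoch q (u * Y) M = qpoch q (u * y) n / qpoch q (u * y) r"
      using nz by (simp add: M Y_def qpoch_add mult.assoc)
    also have "qpoch q (u * X * Y) M = qpoch q (a * q) (n + r) / qpoch q (a * q) (2 * r)"
      using nz qpoch_add[of q "a * q" "2 * r" M] by (simp add: M XY mult_2 add_ac)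
    finally show "(\<Sum>i\<le>n - r. qpoch q x (r + i) * qpoch q y (r + i) * qpoch q u (n - (r + i)) *
             u ^ (r + i) / qpoch q q (n - (r + i)) *
            (\<alpha> r / (qpoch q q (r + i - r) * qpoch q (a * q) (r + i + r)))) =
          qpoch q (u * x) n * qpoch q (u * y) n *
            ((qpoch q x r * qpoch q y r * u ^ r / (qpoch q (u * x) r * qpoch q (u * y) r) * \<alpha> r) /
              (qpoch q q (n - r) * qpoch q (a * q) (n + r)))"
      using nz by (simp add: M)
  qed
  finally show ?thesis by (simp add: bailey_beta_def sum_distrib_left)
qed

text \<open>The first component of the Bailey pair whose second component is the unit sequence; the exponent
  \<open>\<Sum>{..<r}\<close> is the binomial coefficient of \<open>r\<close> over 2.\<close>

definition unit_alpha :: "real \<Rightarrow> complex \<Rightarrow> nat \<Rightarrow> complex" where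
  "unit_alpha q a r = qpoch q a r * (1 - a * of_real q ^ (2 * r)) / (1 - a) * (-1) ^ r *
     of_real q ^ (\<Sum>{..<r}) / qpoch q q r"

text \<open>The sum is indefinitely summable: its partial sums have the closed form
  \<open>part\<close>, found by induction. The closed form contains \<open>qpoch q q (N - m)\<close>
  and therefore stops at \<open>m = N = n - 1\<close>; the remaining term \<open>r = n\<close>
  cancels it.\<close>

lemma bailey_beta_unit:
  assumes q: "0 < q" "q < 1" and a: "qregular q a"
  shows "bailey_beta q a (unit_alpha q a) n = (if n = 0 then 1 else 0)"
proof (cases n)
  case 0
  show ?thesis using qregularD[OF a, of 0] by (simp add: 0 bailey_beta_def unit_alpha_def)
next
  case (Suc N)
  let ?Q = "complex_of_real q"
  have aq: "qregular q (a * q)" using qregular_mult_power[OF a, of 1] by simp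
  note nz = qpoch_nonzero[OF qregular_base[OF q]] qpoch_nonzero[OF aq] 
  have nz': "1 - ?Q * ?Q ^ i \<noteq> 0" "1 - a * ?Q ^ i \<noteq> 0" "a * ?Q ^ i \<noteq> 1" "a \<noteq> 1" for i 
    using qregularD[OF qregular_base[OF q]] qregularD[OF a, of i] qregularD[OF a, of 0] by auto
  have qa: "qpoch q a (Suc r) = (1 - a) * qpoch q (a * ?Q) r" for r
    using qpoch_add[of q a 1 r] by (simp add: qpoch_Suc)
  have part: "m \<le> N \<Longrightarrow> (\<Sum>r\<le>m. unit_alpha q a r / (qpoch q q (n - r) * qpoch q (a * q) (n + r))) =
      qpoch q (a * q) m * (-1) ^ m * ?Q ^ (\<Sum>{..<Suc m}) / (qpoch q q m * qpoch q q (N - m) * 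
      qpoch q (a * q) (n + m) * (1 - ?Q ^ n))" for m
  proof (induction m)
    case 0
    show ?case using nz nz' by (simp add: unit_alpha_def Suc qpoch_Suc)
  next
    case (Suc m)
    then obtain p where p: "N = Suc m + p" by (metis le_Suc_ex)
    have n: "n = m + p + 2" using \<open>n = Suc N\<close> p by simp
    have [simp]: "Suc (Suc (m + p)) - m = Suc (Suc p)" "Suc (m + p) - m = Suc p"
       by auto
    have IH: "(\<Sum>r\<le>m. unit_alpha q a r / (qpoch q q (n - r) * qpoch q (a * q) (n + r))) =
      qpoch q (a * q) m * (-1) ^ m * ?Q ^ (\<Sum>{..<Suc m}) / (qpoch q q m * qpoch q q (N - m) * 
      qpoch q (a * q) (n + m) * (1 - ?Q ^ n))" using Suc by simp
    have k: "1 - ?Q ^ n = 1 - ?Q * ?Q ^ (m + p + 1)" by (simp add: n)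
    define E where "E = ?Q ^ (\<Sum>{..<m})"
    define P where "P = qpoch q (a * ?Q) (n + m)"
    have "P \<noteq> 0" using nz by (simp add: P_def)
    have nm: "n + Suc m = Suc (n + m)" by simp
    have s1: "?Q ^ (\<Sum>{..<Suc m}) = E * ?Q ^ m" "?Q ^ (\<Sum>{..<Suc (Suc m)}) = E * ?Q ^ m * (?Q ^ m * ?Q)" 
      by (simp_all add: E_def power_add)
    have s2: "N - m = Suc p" "N - Suc m = p" "n - Suc m = Suc p" using p n by auto
    show ?case
      unfolding sum.atMost_Suc IH unfolding unit_alpha_def qa k s1 s2 nm qpoch_Suc[of q _ "n+m"] P_def[symmetric]
      using nz nz'(1)[of "m"] nz'(1)[of "p"] nz'(1)[of "m+p+1"] nz'(2)[of "m+1"] nz'(2)[of "n+m+1"] nz'(4) \<open>P \<noteq> 0\<close>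
      apply (simp add: qpoch_Suc power_add n mult_2)
      apply (simp add: divide_simps)
      apply (simp add: algebra_simps)
      done
  qed
  have "bailey_beta q a (unit_alpha q a) n = 
     (\<Sum>r\<le>N. unit_alpha q a r / (qpoch q q (n - r) * qpoch q (a * q) (n + r))) + 
       unit_alpha q a n / (qpoch q q 0 * qpoch q (a * q) (n + n))"
    unfolding bailey_beta_def by (simp add: Suc)
  also have "\<dots> = 0"
    unfolding part[OF order.refl] unfolding unit_alpha_def Suc qa
    using nz nz'(1)[of "N"]  nz'(2)[of "N+1"] nz'(2)[of "n+N+1"] nz'(4)
    apply (simp add: qpoch_Suc power_add mult_2)
    apply (simp add: Suc power_add divide_simps)
    apply (simp add: algebra_simps)
    done
  finally show ?thesis using Suc by simp
qed

subsection \<open>Continuation of q-hypergeometric series\<close>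

text \<open>A pair \<open>N, D\<close> of polynomials with \<open>D(0) = 1\<close> encodes the series whose term ratio is
  \<open>N(q\<^sup>k) / D(q\<^sup>k)\<close>, so the argument of the series is \<open>N(0)\<close>. If moreover \<open>D(1/q) = 0\<close>, the sums
  \<open>F m = (\<Sum>k. c k q\<^bsup>mk\<^esup>)\<close> satisfy a recurrence expressing \<open>(1 - N(0) q\<^sup>m) F m\<close> through the
  \<open>F (m + j)\<close> with \<open>j \<ge> 1\<close>. Read from right to left, it continues \<open>F 0\<close> to all \<open>N(0)\<close> outside
  the points \<open>q\<^bsup>-i\<^esup>\<close>, holomorphically in all coefficients.\<close>

definition qh_term :: "real \<Rightarrow> complex poly \<Rightarrow> complex poly \<Rightarrow> nat \<Rightarrow> complex" where
  "qh_term q N D k = (\<Prod>i<k. poly N (of_real q ^ i) / poly D (of_real q ^ i))"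

definition qh_sum :: "real \<Rightarrow> complex poly \<Rightarrow> complex poly \<Rightarrow> nat \<Rightarrow> complex" where
  "qh_sum q N D m = (\<Sum>k. qh_term q N D k * of_real q ^ (m * k))"

text \<open>\<open>r\<close> counts the uses of the recurrence. Each use raises \<open>m\<close> by
  at least 1, so only sums with index at least \<open>m + r\<close> are evaluated, and they converge
  as soon as \<open>N(0) q^(m+r)\<close> lies in the unit disc.\<close>

fun qh_ext :: "real \<Rightarrow> complex poly \<Rightarrow> complex poly \<Rightarrow> nat \<Rightarrow> nat \<Rightarrow> complex" where
  "qh_ext q N D 0 m = qh_sum q N D m"
| "qh_ext q N D (Suc r) m =
     (\<Sum>j=1..max (degree N) (degree D).
        (of_real q ^ m * coeff N j - coeff D j / of_real q ^ j) * qh_ext q N D r (m + j)) /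
     (1 - coeff N 0 * of_real q ^ m)"

definition qh :: "real \<Rightarrow> complex poly \<Rightarrow> complex poly \<Rightarrow> complex" where
  "qh q N D = qh_ext q N D (LEAST r. norm (coeff N 0 * of_real q ^ r) < 1) 0"

lemma poly_altdef_le:
  fixes x :: "'a::comm_semiring_1"
  assumes "degree p \<le> L"
  shows "poly p x = (\<Sum>j\<le>L. coeff p j * x ^ j)"
  unfolding poly_altdef
  by (rule sum.mono_neutral_left) (use assms in \<open>auto simp: coeff_eq_0\<close>)

text \<open>As a function of \<open>t\<close> and \<open>s = q^k\<close>, the term ratio is
  continuous at \<open>(t0, 0)\<close>, because the denominator has constant coefficient 1. The
  limit along the product filter thus gives one geometric bound for all \<open>t\<close> near
  \<open>t0\<close> and all large \<open>k\<close>.\<close>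

lemma qh_ratio_bound:
  fixes N D :: "complex \<Rightarrow> complex poly"
  assumes q: "0 < q" "q < 1" and A: "open A" "t0 \<in> A"
    and deg: "\<And>t. t \<in> A \<Longrightarrow> degree (N t) \<le> L" "\<And>t. t \<in> A \<Longrightarrow> degree (D t) \<le> L"
    and cont: "\<And>j. continuous_on A (\<lambda>t. coeff (N t) j)" "\<And>j. continuous_on A (\<lambda>t. coeff (D t) j)"
    and D0: "\<And>t. t \<in> A \<Longrightarrow> coeff (D t) 0 = 1"
    and small: "norm (coeff (N t0) 0 * of_real q ^ m) < 1"
  obtains \<delta> \<rho> K where "\<delta> > 0" "cball t0 \<delta> \<subseteq> A" "0 < \<rho>" "\<rho> < 1"
    "\<And>t k. t \<in> cball t0 \<delta> \<Longrightarrow> k \<ge> K \<Longrightarrow>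
       norm (poly (N t) (of_real q ^ k) / poly (D t) (of_real q ^ k) * of_real q ^ m) \<le> \<rho>"
proof -
  let ?Q = "complex_of_real q"
  let ?F = "nhds t0 \<times>\<^sub>F nhds (0::complex)"
  obtain \<rho> where \<rho>: "norm (coeff (N t0) 0 * ?Q ^ m) < \<rho>" "\<rho> < 1"
    using dense[OF small] by blast
  have coef: "((\<lambda>x. coeff (P (fst x)) j * snd x ^ j) \<longlongrightarrow> coeff (P t0) j * 0 ^ j) ?F"
    if "\<And>j. continuous_on A (\<lambda>t. coeff (P t) j)" for P :: "complex \<Rightarrow> complex poly" and j
  proof -
    have "((\<lambda>t. coeff (P t) j) \<longlongrightarrow> coeff (P t0) j) (nhds t0)"
      using that[of j] A
      by (intro iffD1[OF tendsto_at_iff_tendsto_nhds[of "\<lambda>t. coeff (P t) j"]])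
         (simp add: continuous_on_eq_continuous_at continuous_at)
    hence "((\<lambda>x. coeff (P (fst x)) j) \<longlongrightarrow> coeff (P t0) j) ?F"
      by (rule filterlim_compose) (rule filterlim_fst)
    moreover have "(snd \<longlongrightarrow> (0::complex)) ?F" by (rule filterlim_snd)
    ultimately show ?thesis by (intro tendsto_intros)
  qed
  define h where "h x = (\<Sum>j\<le>L. coeff (N (fst x)) j * snd x ^ j) /
     (\<Sum>j\<le>L. coeff (D (fst x)) j * snd x ^ j) * ?Q ^ m" for x
  have z: "(\<Sum>j\<le>L. c j * 0 ^ j) = c 0" for c :: "nat \<Rightarrow> complex"
    by (subst sum.atMost_shift) simp
  have "(h \<longlongrightarrow> (\<Sum>j\<le>L. coeff (N t0) j * 0 ^ j) / (\<Sum>j\<le>L. coeff (D t0) j * 0 ^ j) * ?Q ^ m) ?F"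
    unfolding h_def using D0[OF A(2)]
    by (intro tendsto_intros coef cont) (simp add: z)
  hence "(h \<longlongrightarrow> coeff (N t0) 0 * ?Q ^ m) ?F"
    using D0[OF A(2)] by (simp add: z)
  hence "((\<lambda>x. norm (h x)) \<longlongrightarrow> norm (coeff (N t0) 0 * ?Q ^ m)) ?F"
    by (rule tendsto_norm)
  hence "eventually (\<lambda>x. norm (h x) < \<rho>) ?F"
    using \<rho>(1) by (rule order_tendstoD)
  then obtain P R where PR: "eventually P (nhds t0)" "eventually R (nhds 0)"
     "\<And>t s. P t \<Longrightarrow> R s \<Longrightarrow> norm (h (t, s)) < \<rho>"
    unfolding eventually_prod_filter by auto
  have "eventually (\<lambda>t. t \<in> A) (nhds t0)" using A by (rule eventually_nhds_in_open)
  with PR(1) have "eventually (\<lambda>t. t \<in> A \<and> P t) (nhds t0)" by eventually_elim auto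
  then obtain d where d: "d > 0" "\<And>t. dist t t0 < d \<Longrightarrow> t \<in> A \<and> P t"
    unfolding eventually_nhds_metric by blast
  have "(\<lambda>k. ?Q ^ k) \<longlonglongrightarrow> 0" using q by (intro LIMSEQ_power_zero) auto
  hence "eventually (\<lambda>k. R (?Q ^ k)) sequentially"
    using PR(2) by (rule eventually_compose_filterlim[rotated])
  then obtain K where K: "\<And>k. k \<ge> K \<Longrightarrow> R (?Q ^ k)"
    unfolding eventually_sequentially by blast
  show ?thesis
  proof (rule that[of "d / 2" \<rho> K])
    have *: "t \<in> A" "P t" if "t \<in> cball t0 (d / 2)" for t
      using d(2)[of t] that d(1) by (auto simp: dist_commute)
    show "cball t0 (d / 2) \<subseteq> A" using * by auto
    show "d / 2 > 0" using d by simp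
    show "0 < \<rho>" using \<rho>(1) norm_ge_zero by (rule le_less_trans[rotated])
    show "\<rho> < 1" by fact
    fix t k assume t: "t \<in> cball t0 (d / 2)" and k: "k \<ge> K"
    have "norm (h (t, ?Q ^ k)) < \<rho>" using *[OF t] K[OF k] PR(3) by blast
    thus "norm (poly (N t) (?Q ^ k) / poly (D t) (?Q ^ k) * ?Q ^ m) \<le> \<rho>"
      using *[OF t] by (simp add: h_def poly_altdef_le[OF deg(1)] poly_altdef_le[OF deg(2)])
  qed
qed

lemma qh_term_Suc: "qh_term q N D (Suc k) =
  qh_term q N D k * (poly N (of_real q ^ k) / poly D (of_real q ^ k))"
  by (simp add: qh_term_def)

lemma qh_term_bound:
  assumes r: "\<And>k. k \<ge> K \<Longrightarrow> norm (poly N (of_real q ^ k) / poly D (of_real q ^ k) * of_real q ^ m) \<le> \<rho>"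
    and "\<rho> > 0" and "k \<ge> K"
  shows "norm (qh_term q N D k * of_real q ^ (m * k)) \<le>
         norm (qh_term q N D K * of_real q ^ (m * K)) * \<rho> ^ (k - K)"
  using \<open>k \<ge> K\<close>
proof (induction k rule: dec_induct)
  case base
  show ?case by simp
next
  case (step n)
  have "norm (qh_term q N D (Suc n) * of_real q ^ (m * Suc n)) =
        norm (qh_term q N D n * of_real q ^ (m * n)) *
        norm (poly N (of_real q ^ n) / poly D (of_real q ^ n) * of_real q ^ m)"
    unfolding norm_mult[symmetric] by (simp add: qh_term_Suc power_add mult_ac)
  also have "\<dots> \<le> (norm (qh_term q N D K * of_real q ^ (m * K)) * \<rho> ^ (n - K)) * \<rho>"
    by (intro mult_mono step.IH r step.hyps) (use \<open>\<rho> > 0\<close> in auto)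
  finally show ?case using step.hyps by (simp add: Suc_diff_le mult_ac)
qed

lemma geometric_shift_summable:
  fixes \<rho> :: real
  assumes "0 < \<rho>" "\<rho> < 1"
  shows "summable (\<lambda>k. B * \<rho> ^ (k - K))"
proof -
  have "summable (\<lambda>k. B * \<rho> ^ k)" using assms by (intro summable_mult summable_geometric) auto
  hence "summable (\<lambda>k. B * \<rho> ^ (k + K - K))" by simp
  thus ?thesis by (rule summable_iff_shift[THEN iffD1, where k1 = K])
qed

lemma qh_summable:
  assumes q: "0 < q" "q < 1" and "coeff D 0 = 1" and "norm (coeff N 0 * of_real q ^ m) < 1"
  shows "summable (\<lambda>k. qh_term q N D k * of_real q ^ (m * k))"
proof -
  obtain \<rho> K where \<rho>: "0 < \<rho>" "\<rho> < 1" and r: "\<And>k. k \<ge> K \<Longrightarrow>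
       norm (poly N (of_real q ^ k) / poly D (of_real q ^ k) * of_real q ^ m) \<le> \<rho>"
  proof (rule qh_ratio_bound[OF q, of UNIV 0 "\<lambda>_. N" "max (degree N) (degree D)" "\<lambda>_. D" m])
    fix \<delta> \<rho> :: real and K
    assume *: "\<delta> > 0" "0 < \<rho>" "\<rho> < 1" 
      "\<And>t k. t \<in> cball (0::complex) \<delta> \<Longrightarrow> k \<ge> K \<Longrightarrow>
        norm (poly N (of_real q ^ k) / poly D (of_real q ^ k) * of_real q ^ m) \<le> \<rho>"
    show thesis
      by (rule that[OF *(2,3)], rule *(4)[of 0]) (use *(1) in auto)
  qed (use assms in auto)
  show ?thesis
  proof (rule summable_comparison_test_ev[OF _ geometric_shift_summable[OF \<rho>]])
    show "eventually (\<lambda>k. norm (qh_term q N D k * of_real q ^ (m * k)) \<le>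
         norm (qh_term q N D K * of_real q ^ (m * K)) * \<rho> ^ (k - K)) sequentially"
      using eventually_ge_at_top[of K] by eventually_elim (rule qh_term_bound[OF r \<rho>(1)])
  qed
qed

lemma qh_term_holomorphic:
  assumes "\<And>j. (\<lambda>t. coeff (N t) j) holomorphic_on A" "\<And>j. (\<lambda>t. coeff (D t) j) holomorphic_on A"
    and deg: "\<And>t. t \<in> A \<Longrightarrow> degree (N t) \<le> L" "\<And>t. t \<in> A \<Longrightarrow> degree (D t) \<le> L"
    and "\<And>t k. t \<in> A \<Longrightarrow> poly (D t) (of_real q ^ k) \<noteq> 0"
  shows "(\<lambda>t. qh_term q (N t) (D t) k) holomorphic_on A"
proof -
  have p: "(\<lambda>t. poly (P t) x) holomorphic_on A"
    if "\<And>j. (\<lambda>t. coeff (P t) j) holomorphic_on A" "\<And>t. t \<in> A \<Longrightarrow> degree (P t) \<le> L" for P :: "complex \<Rightarrow> complex poly" and x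
  proof -
    have "(\<lambda>t. \<Sum>j\<le>L. coeff (P t) j * x ^ j) holomorphic_on A"
      by (intro holomorphic_intros that)
    thus ?thesis by (rule holomorphic_transform) (simp add: poly_altdef_le[OF that(2)])
  qed
  show ?thesis unfolding qh_term_def
    by (intro holomorphic_intros p assms) auto
qed

text \<open>The term of index \<open>K\<close> is continuous in \<open>t\<close>, hence bounded on a
  compact disc, and from there on the terms are dominated by a geometric series. The M-test makes
  the limit of the holomorphic partial sums locally uniform.\<close>

lemma qh_sum_holomorphic:
  fixes N D :: "complex \<Rightarrow> complex poly"
  assumes q: "0 < q" "q < 1" and A: "open A"
    and hol: "\<And>j. (\<lambda>t. coeff (N t) j) holomorphic_on A" "\<And>j. (\<lambda>t. coeff (D t) j) holomorphic_on A"
    and deg: "\<And>t. t \<in> A \<Longrightarrow> degree (N t) \<le> L" "\<And>t. t \<in> A \<Longrightarrow> degree (D t) \<le> L"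
    and D0: "\<And>t. t \<in> A \<Longrightarrow> coeff (D t) 0 = 1"
    and D: "\<And>t k. t \<in> A \<Longrightarrow> poly (D t) (of_real q ^ k) \<noteq> 0"
    and small: "\<And>t. t \<in> A \<Longrightarrow> norm (coeff (N t) 0 * of_real q ^ m) < 1"
  shows "(\<lambda>t. qh_sum q (N t) (D t) m) holomorphic_on A"
proof (rule holomorphic_uniform_sequence[OF A])
  let ?f = "\<lambda>n t. \<Sum>k<n. qh_term q (N t) (D t) k * of_real q ^ (m * k)"
  show "?f n holomorphic_on A" for n
    by (intro holomorphic_intros qh_term_holomorphic[OF hol deg D])
  fix t0 assume t0: "t0 \<in> A"
  have cont: "\<And>j. continuous_on A (\<lambda>t. coeff (N t) j)" "\<And>j. continuous_on A (\<lambda>t. coeff (D t) j)"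
    using hol by (auto intro: holomorphic_on_imp_continuous_on)
  obtain \<delta> \<rho> K where \<rho>: "\<delta> > 0" "cball t0 \<delta> \<subseteq> A" "0 < \<rho>" "\<rho> < 1"
    "\<And>t k. t \<in> cball t0 \<delta> \<Longrightarrow> k \<ge> K \<Longrightarrow>
       norm (poly (N t) (of_real q ^ k) / poly (D t) (of_real q ^ k) * of_real q ^ m) \<le> \<rho>"
    using qh_ratio_bound[OF q A t0 deg cont D0 small[OF t0]] by blast
  have "continuous_on A (\<lambda>t. qh_term q (N t) (D t) K * of_real q ^ (m * K))"
    by (intro continuous_intros holomorphic_on_imp_continuous_on qh_term_holomorphic[OF hol deg D])
  hence "continuous_on (cball t0 \<delta>) (\<lambda>t. qh_term q (N t) (D t) K * of_real q ^ (m * K))"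
    using \<rho>(2) by (rule continuous_on_subset)
  hence "bounded ((\<lambda>t. qh_term q (N t) (D t) K * of_real q ^ (m * K)) ` cball t0 \<delta>)"
    by (intro compact_imp_bounded compact_continuous_image) auto
  then obtain B where B: "\<And>t. t \<in> cball t0 \<delta> \<Longrightarrow> norm (qh_term q (N t) (D t) K * of_real q ^ (m * K)) \<le> B"
    unfolding bounded_iff by blast
  have "uniform_limit (cball t0 \<delta>) ?f (\<lambda>t. qh_sum q (N t) (D t) m) sequentially"
    unfolding qh_sum_def
  proof (rule Weierstrass_m_test_ev[OF _ geometric_shift_summable[OF \<rho>(3,4)]])
    show "\<forall>\<^sub>F k in sequentially. \<forall>t\<in>cball t0 \<delta>.
       norm (qh_term q (N t) (D t) k * of_real q ^ (m * k)) \<le> B * \<rho> ^ (k - K)"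
      using eventually_ge_at_top[of K]
    proof eventually_elim
      case (elim k)
      show ?case
      proof
        fix t assume t: "t \<in> cball t0 \<delta>"
        have "norm (qh_term q (N t) (D t) k * of_real q ^ (m * k)) \<le>
          norm (qh_term q (N t) (D t) K * of_real q ^ (m * K)) * \<rho> ^ (k - K)"
          by (rule qh_term_bound[OF \<rho>(5)[OF t] \<rho>(3) elim])
        also have "\<dots> \<le> B * \<rho> ^ (k - K)"
          using B[OF t] \<rho>(3) by (intro mult_right_mono) auto
        finally show "norm (qh_term q (N t) (D t) k * of_real q ^ (m * k)) \<le> B * \<rho> ^ (k - K)" .
      qed
    qed
  qed
  thus "\<exists>d>0. cball t0 d \<subseteq> A \<and> uniform_limit (cball t0 d) ?f (\<lambda>t. qh_sum q (N t) (D t) m) sequentially"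
    using \<rho> by blast
qed

text \<open>The assumption is summability and not
  \<open>norm (coeff N 0 * of_real q ^ m) < 1\<close>, so that the recurrence and
  \<open>qh_eq_sum\<close> also apply to terminating series whose argument is large. The shifted
  series is the same power series at a smaller point.\<close>

lemma qh_summable_shift:
  assumes q: "0 < q" "q < 1" and S: "summable (\<lambda>k. qh_term q N D k * of_real q ^ (m * k))"
  shows "summable (\<lambda>k. qh_term q N D k * of_real q ^ ((m + j) * k))"
proof (cases "j = 0")
  case False
  have "summable (\<lambda>k. qh_term q N D k * (of_real q ^ m) ^ k)"
    using S by (simp add: power_mult)
  hence "summable (\<lambda>k. qh_term q N D k * (of_real q ^ (m + j)) ^ k)"
  proof (rule powser_inside)
    have "q ^ (m + j) < q ^ m" using q False by (intro power_strict_decreasing) auto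
    thus "norm (complex_of_real q ^ (m + j)) < norm (complex_of_real q ^ m)"
      using q by (simp add: norm_power)
  qed
  thus ?thesis by (simp only: power_mult)
qed (use S in simp)

text \<open>The relation \<open>D(q^k) c(k+1) = N(q^k) c(k)\<close> is multiplied by
  \<open>q^(m(k+1))\<close> and summed over \<open>k\<close>. The sums on the left start at index 1
  and so lack the term 1; with their coefficients these missing terms add up to
  \<open>D(1/q) = 0\<close>, which makes the recurrence homogeneous. The terms with
  \<open>j = 0\<close> form its left-hand side.\<close>

lemma qh_sum_recurrence:
  assumes q: "0 < q" "q < 1" and S: "summable (\<lambda>k. qh_term q N D k * of_real q ^ (m * k))"
    and deg: "degree N \<le> L" "degree D \<le> L"
    and D0: "coeff D 0 = 1" and D1: "poly D (1 / of_real q) = 0"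
    and D: "\<And>k. poly D (of_real q ^ k) \<noteq> 0"
  shows "(1 - coeff N 0 * of_real q ^ m) * qh_sum q N D m =
     (\<Sum>j=1..L. (of_real q ^ m * coeff N j - coeff D j / of_real q ^ j) * qh_sum q N D (m + j))"
proof -
  let ?Q = "complex_of_real q"
  let ?c = "qh_term q N D"
  have Q: "?Q \<noteq> 0" using q by simp
  have sums: "(\<lambda>k. ?c k * ?Q ^ ((m + j) * k)) sums qh_sum q N D (m + j)" for j
    unfolding qh_sum_def using qh_summable_shift[OF q S] by (rule summable_sums)
  have sums': "(\<lambda>k. ?c (Suc k) * ?Q ^ ((m + j) * Suc k)) sums (qh_sum q N D (m + j) - 1)" for j
    using sums[of j] sums_Suc_iff[of "\<lambda>k. ?c k * ?Q ^ ((m + j) * k)" "qh_sum q N D (m + j) - 1"]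
    by (simp add: qh_term_def)
  have "(\<lambda>k. \<Sum>j\<le>L. (coeff D j / ?Q ^ j) * (?c (Suc k) * ?Q ^ ((m + j) * Suc k))) sums
     (\<Sum>j\<le>L. (coeff D j / ?Q ^ j) * (qh_sum q N D (m + j) - 1))"
    by (intro sums_sum sums_mult sums')
  moreover have "(\<Sum>j\<le>L. (coeff D j / ?Q ^ j) * (?c (Suc k) * ?Q ^ ((m + j) * Suc k))) =
     (\<Sum>j\<le>L. (?Q ^ m * coeff N j) * (?c k * ?Q ^ ((m + j) * k)))" for k
  proof -
    have "(\<Sum>j\<le>L. (coeff D j / ?Q ^ j) * (?c (Suc k) * ?Q ^ ((m + j) * Suc k))) =
       ?c (Suc k) * ?Q ^ (m * Suc k) * (\<Sum>j\<le>L. coeff D j * (?Q ^ k) ^ j)"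
      unfolding sum_distrib_left using Q
      by (intro sum.cong refl) (simp add: algebra_simps power_add power_mult_distrib flip: power_mult)
    also have "\<dots> = ?c k * ?Q ^ (m * Suc k) * poly N (?Q ^ k)"
      unfolding poly_altdef_le[OF deg(2), symmetric] qh_term_Suc using D[of k] by simp
    also have "\<dots> = (\<Sum>j\<le>L. (?Q ^ m * coeff N j) * (?c k * ?Q ^ ((m + j) * k)))"
      unfolding poly_altdef_le[OF deg(1)] sum_distrib_left
      by (intro sum.cong refl) (simp add: algebra_simps power_add power_mult_distrib flip: power_mult)
    finally show ?thesis .
  qed
  moreover have "(\<lambda>k. \<Sum>j\<le>L. (?Q ^ m * coeff N j) * (?c k * ?Q ^ ((m + j) * k))) sums
     (\<Sum>j\<le>L. (?Q ^ m * coeff N j) * qh_sum q N D (m + j))"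
    by (intro sums_sum sums_mult sums)
  ultimately have "(\<Sum>j\<le>L. (coeff D j / ?Q ^ j) * (qh_sum q N D (m + j) - 1)) =
    (\<Sum>j\<le>L. (?Q ^ m * coeff N j) * qh_sum q N D (m + j))"
    by (simp add: sums_unique2)
  moreover have "(\<Sum>j\<le>L. coeff D j / ?Q ^ j) = 0"
    using D1 unfolding poly_altdef_le[OF deg(2)] by (simp add: power_divide)
  ultimately have *: "(\<Sum>j\<le>L. (?Q ^ m * coeff N j - coeff D j / ?Q ^ j) * qh_sum q N D (m + j)) = 0"
    by (simp add: algebra_simps sum_subtractf sum.distrib)
  have "{..L} = insert 0 {1..L}" by auto
  with * show ?thesis by (simp add: D0 algebra_simps)
qed

lemma qh_ext_eq_sum:
  assumes q: "0 < q" "q < 1" and S: "summable (\<lambda>k. qh_term q N D k * of_real q ^ (m * k))"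
    and D0: "coeff D 0 = 1" and D1: "poly D (1 / of_real q) = 0"
    and D: "\<And>k. poly D (of_real q ^ k) \<noteq> 0"
    and N0: "\<And>k. coeff N 0 * of_real q ^ k \<noteq> 1"
  shows "qh_ext q N D r m = qh_sum q N D m"
  using S
proof (induction r arbitrary: m)
  case (Suc r)
  have "(1 - coeff N 0 * of_real q ^ m) * qh_sum q N D m =
     (\<Sum>j=1..max (degree N) (degree D). (of_real q ^ m * coeff N j - coeff D j / of_real q ^ j) * qh_sum q N D (m + j))"
    by (rule qh_sum_recurrence[OF q Suc.prems _ _ D0 D1 D]) auto
  moreover have "1 - coeff N 0 * of_real q ^ m \<noteq> 0" using N0[of m] by simp
  ultimately show ?case
    using Suc.IH[OF qh_summable_shift[OF q Suc.prems]]
    by (simp add: field_simps)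
qed simp

lemma norm_mult_power_antimono:
  assumes "0 < q" "q < 1" "norm (x * complex_of_real q ^ r) < 1" "r \<le> s"
  shows "norm (x * complex_of_real q ^ s) < 1"
proof -
  have "norm x * q ^ s \<le> norm x * q ^ r"
    using assms by (intro mult_left_mono power_decreasing) auto
  thus ?thesis using assms by (simp add: norm_mult norm_power)
qed

lemma qh_ext_stable:
  assumes q: "0 < q" "q < 1" 
    and D0: "coeff D 0 = 1" and D1: "poly D (1 / of_real q) = 0"
    and D: "\<And>k. poly D (of_real q ^ k) \<noteq> 0"
    and N0: "\<And>k. coeff N 0 * of_real q ^ k \<noteq> 1"
    and small: "norm (coeff N 0 * of_real q ^ (m + r)) < 1" and "r \<le> r'"
  shows "qh_ext q N D r' m = qh_ext q N D r m"
  using small \<open>r \<le> r'\<close>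
proof (induction r arbitrary: r' m)
  case 0
  show ?case
    using 0 by (simp add: qh_ext_eq_sum[OF q qh_summable[OF q D0] D0 D1 D N0])
next
  case (Suc r)
  then obtain r'' where r'': "r' = Suc r''" "r \<le> r''" by (cases r') auto
  have "qh_ext q N D r'' (m + j) = qh_ext q N D r (m + j)" if "j \<ge> 1" for j
    by (rule Suc.IH[OF norm_mult_power_antimono[OF q Suc.prems(1)] r''(2)]) (use that in auto)
  thus ?case by (simp add: r'')
qed

lemma ex_norm_mult_power_less:
  assumes "0 < q" "q < 1"
  shows "\<exists>r. norm (x * complex_of_real q ^ r) < 1"
proof -
  have "(\<lambda>r. x * complex_of_real q ^ r) \<longlonglongrightarrow> x * 0"
    using assms by (intro tendsto_intros LIMSEQ_power_zero) auto
  hence "(\<lambda>r. norm (x * complex_of_real q ^ r)) \<longlonglongrightarrow> 0"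
    by (auto intro: tendsto_norm_zero)
  hence "eventually (\<lambda>r. norm (x * complex_of_real q ^ r) < 1) sequentially"
    by (rule order_tendstoD) simp
  thus ?thesis by (auto simp: eventually_sequentially)
qed

lemma qh_eq_ext:
  assumes q: "0 < q" "q < 1" 
    and D0: "coeff D 0 = 1" and D1: "poly D (1 / of_real q) = 0"
    and D: "\<And>k. poly D (of_real q ^ k) \<noteq> 0"
    and N0: "\<And>k. coeff N 0 * of_real q ^ k \<noteq> 1"
    and small: "norm (coeff N 0 * of_real q ^ r) < 1"
  shows "qh q N D = qh_ext q N D r 0"
  unfolding qh_def
proof (rule qh_ext_stable[OF q D0 D1 D N0, symmetric])
  show "norm (coeff N 0 * of_real q ^ (0 + (LEAST r. norm (coeff N 0 * of_real q ^ r) < 1))) < 1"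
    using LeastI[of "\<lambda>r. norm (coeff N 0 * of_real q ^ r) < 1", OF small] by simp
  show "(LEAST r. norm (coeff N 0 * of_real q ^ r) < 1) \<le> r"
    by (rule Least_le) fact
qed

lemma qh_eq_sum:
  assumes q: "0 < q" "q < 1" 
    and D0: "coeff D 0 = 1" and D1: "poly D (1 / of_real q) = 0"
    and D: "\<And>k. poly D (of_real q ^ k) \<noteq> 0"
    and N0: "\<And>k. coeff N 0 * of_real q ^ k \<noteq> 1"
    and S: "summable (qh_term q N D)"
  shows "qh q N D = (\<Sum>k. qh_term q N D k)"
  unfolding qh_def using qh_ext_eq_sum[OF q _ D0 D1 D N0, of 0] S by (simp add: qh_sum_def)

lemma qh_ext_holomorphic:
  fixes N D :: "complex \<Rightarrow> complex poly"
  assumes q: "0 < q" "q < 1" and A: "open A"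
    and hol: "\<And>j. (\<lambda>t. coeff (N t) j) holomorphic_on A" "\<And>j. (\<lambda>t. coeff (D t) j) holomorphic_on A"
    and deg: "\<And>t. t \<in> A \<Longrightarrow> degree (N t) \<le> L" "\<And>t. t \<in> A \<Longrightarrow> degree (D t) \<le> L"
    and D0: "\<And>t. t \<in> A \<Longrightarrow> coeff (D t) 0 = 1"
    and D: "\<And>t k. t \<in> A \<Longrightarrow> poly (D t) (of_real q ^ k) \<noteq> 0"
    and N0: "\<And>t k. t \<in> A \<Longrightarrow> coeff (N t) 0 * of_real q ^ k \<noteq> 1"
    and small: "\<And>t. t \<in> A \<Longrightarrow> norm (coeff (N t) 0 * of_real q ^ (m + r)) < 1"
  shows "(\<lambda>t. qh_ext q (N t) (D t) r m) holomorphic_on A"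
  using small
proof (induction r arbitrary: m)
  case 0
  thus ?case using qh_sum_holomorphic[OF q A hol deg D0 D, of m] by simp
next
  case (Suc r)
  have IH: "(\<lambda>t. qh_ext q (N t) (D t) r (m + j)) holomorphic_on A" if "j \<in> {1..L}" for j
    by (rule Suc.IH, rule norm_mult_power_antimono[OF q Suc.prems]) (use that in auto)
  \<comment> \<open>The summation bound in \<open>qh_ext\<close> depends on the degrees at
    \<open>t\<close>. The fixed bound \<open>L\<close> adds only vanishing coefficients and yields
    an expression that is visibly holomorphic.\<close>
  have "(\<lambda>t. (\<Sum>j=1..L. (of_real q ^ m * coeff (N t) j - coeff (D t) j / of_real q ^ j) *
     qh_ext q (N t) (D t) r (m + j)) / (1 - coeff (N t) 0 * of_real q ^ m)) holomorphic_on A"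
    by (intro holomorphic_intros hol IH) (use N0[of _ m] q in auto)
  thus ?case
  proof (rule holomorphic_transform)
    fix t assume t: "t \<in> A"
    have "(\<Sum>j=1..L. (of_real q ^ m * coeff (N t) j - coeff (D t) j / of_real q ^ j) *
       qh_ext q (N t) (D t) r (m + j)) = 
      (\<Sum>j=1..max (degree (N t)) (degree (D t)). (of_real q ^ m * coeff (N t) j - coeff (D t) j / of_real q ^ j) *
       qh_ext q (N t) (D t) r (m + j))"
      by (rule sum.mono_neutral_right) (use deg[OF t] in \<open>auto simp: coeff_eq_0\<close>)
    thus "(\<Sum>j=1..L. (of_real q ^ m * coeff (N t) j - coeff (D t) j / of_real q ^ j) *
       qh_ext q (N t) (D t) r (m + j)) / (1 - coeff (N t) 0 * of_real q ^ m) =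
      qh_ext q (N t) (D t) (Suc r) m" by simp
  qed
qed

text \<open>The number of recurrence steps chosen in \<open>qh\<close> is a least one and may jump
  as \<open>t\<close> varies. Near \<open>t0\<close> a single number \<open>r\<close> suffices for
  every \<open>t\<close>, and \<open>qh_eq_ext\<close> shows that the value does not depend on this
  choice.\<close>

lemma qh_holomorphic:
  fixes N D :: "complex \<Rightarrow> complex poly"
  assumes q: "0 < q" "q < 1" and A: "open A"
    and hol: "\<And>j. (\<lambda>t. coeff (N t) j) holomorphic_on A" "\<And>j. (\<lambda>t. coeff (D t) j) holomorphic_on A"
    and deg: "\<And>t. t \<in> A \<Longrightarrow> degree (N t) \<le> L" "\<And>t. t \<in> A \<Longrightarrow> degree (D t) \<le> L"
    and D0: "\<And>t. t \<in> A \<Longrightarrow> coeff (D t) 0 = 1"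
    and D1: "\<And>t. t \<in> A \<Longrightarrow> poly (D t) (1 / of_real q) = 0"
    and D: "\<And>t k. t \<in> A \<Longrightarrow> poly (D t) (of_real q ^ k) \<noteq> 0"
    and N0: "\<And>t k. t \<in> A \<Longrightarrow> coeff (N t) 0 * of_real q ^ k \<noteq> 1"
  shows "(\<lambda>t. qh q (N t) (D t)) holomorphic_on A"
  unfolding holomorphic_on_def
proof
  fix t0 assume t0: "t0 \<in> A"
  obtain r where r: "norm (coeff (N t0) 0 * of_real q ^ r) < 1"
    using ex_norm_mult_power_less[OF q] by blast
  define B where "B = A \<inter> (\<lambda>t. norm (coeff (N t) 0 * of_real q ^ r)) -` {..<1}"
  have "continuous_on A (\<lambda>t. coeff (N t) 0)" by (intro holomorphic_on_imp_continuous_on hol)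
  hence "continuous_on A (\<lambda>t. norm (coeff (N t) 0 * of_real q ^ r))" by (intro continuous_intros)
  hence B: "open B" unfolding B_def using A by (rule continuous_open_preimage) auto
  have BA: "B \<subseteq> A" by (auto simp: B_def)
  have "(\<lambda>t. qh_ext q (N t) (D t) r 0) holomorphic_on B"
  proof (rule qh_ext_holomorphic[OF q B])
    show "\<And>j. (\<lambda>t. coeff (N t) j) holomorphic_on B" "\<And>j. (\<lambda>t. coeff (D t) j) holomorphic_on B"
      using hol BA by (auto intro: holomorphic_on_subset)
  qed (use deg D0 D N0 BA in \<open>auto simp: B_def\<close>)
  hence "(\<lambda>t. qh q (N t) (D t)) holomorphic_on B"
  proof (rule holomorphic_transform)
    fix t assume "t \<in> B"
    hence t: "t \<in> A" "norm (coeff (N t) 0 * of_real q ^ r) < 1" by (auto simp: B_def)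
    show "qh_ext q (N t) (D t) r 0 = qh q (N t) (D t)"
      by (rule qh_eq_ext[OF q D0[OF t(1)] D1[OF t(1)] D[OF t(1)] N0[OF t(1)] t(2), symmetric])
  qed
  moreover have "t0 \<in> B" using t0 r by (simp add: B_def)
  ultimately show "(\<lambda>t. qh q (N t) (D t)) field_differentiable at t0 within A"
    using B holomorphic_on_imp_differentiable_at field_differentiable_at_within by blast
qed

subsection \<open>Infinite products\<close>

lemma qpoch_inf_eq_0_iff:
  assumes q: "0 < q" "q < 1"
  shows "qpoch_inf q x = 0 \<longleftrightarrow> \<not> qregular q x"
proof -
  have "summable (\<lambda>i. norm ((1 - x * complex_of_real q ^ i) - 1))"
    using q by (simp add: norm_mult norm_power summable_mult summable_geometric)
  hence "convergent_prod (\<lambda>i. 1 - x * complex_of_real q ^ i)"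
    by (intro abs_convergent_prod_imp_convergent_prod summable_imp_abs_convergent_prod)
  hence "(\<lambda>i. 1 - x * complex_of_real q ^ i) has_prod qpoch_inf q x"
    unfolding qpoch_inf_def by (rule convergent_prod_has_prod)
  from has_prod_eq_0_iff[OF this] show ?thesis
    by (auto simp: qregular_def)
qed

lemma qpoch_inf_0 [simp]: "qpoch_inf q 0 = 1"
  by (simp add: qpoch_inf_def)

lemma qpoch_inf_holomorphic_UNIV:
  assumes q: "0 < q" "q < 1"
  shows "qpoch_inf q holomorphic_on UNIV"
proof (rule holomorphic_uniform_sequence)
  let ?f = "\<lambda>n x. \<Prod>i<n. 1 - x * complex_of_real q ^ i"
  show "?f n holomorphic_on UNIV" for n
    by (intro holomorphic_intros)
  fix x0 :: complex
  have "uniformly_convergent_on (cball x0 1) (\<lambda>N x. \<Sum>n<N. norm ((1 - x * complex_of_real q ^ n) - 1))"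
  proof (rule Weierstrass_m_test')
    fix n x assume "x \<in> cball x0 1"
    hence "norm x \<le> norm x0 + 1"
      by (metis dist_commute dist_norm mem_cball norm_triangle_sub add.commute add_mono_thms_linordered_semiring(3) order.trans)
    thus "norm (norm ((1 - x * complex_of_real q ^ n) - 1)) \<le> (norm x0 + 1) * q ^ n"
      using q by (simp add: norm_mult norm_power mult_right_mono)
  next
    show "summable (\<lambda>n. (norm x0 + 1) * q ^ n)"
      using q by (intro summable_mult summable_geometric) auto
  qed
  hence "uniformly_convergent_on (cball x0 1) ?f"
    by (intro uniformly_convergent_on_prod') (auto intro!: continuous_intros)
  then obtain g where g: "uniform_limit (cball x0 1) ?f g sequentially"
    unfolding uniformly_convergent_on_def by blast
  also have "?this \<longleftrightarrow> uniform_limit (cball x0 1) ?f (qpoch_inf q) sequentially"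
  proof (intro uniform_limit_cong)
    fix x assume x: "x \<in> cball x0 1"
    have "summable (\<lambda>i. norm ((1 - x * complex_of_real q ^ i) - 1))"
      using q by (simp add: norm_mult norm_power summable_mult summable_geometric)
    hence "convergent_prod (\<lambda>i. 1 - x * complex_of_real q ^ i)"
      by (intro abs_convergent_prod_imp_convergent_prod summable_imp_abs_convergent_prod)
    hence "(\<lambda>n. \<Prod>i\<le>n. 1 - x * complex_of_real q ^ i) \<longlonglongrightarrow> qpoch_inf q x"
      unfolding qpoch_inf_def by (rule convergent_prod_LIMSEQ)
    moreover have "(\<lambda>n. ?f (Suc n) x) \<longlonglongrightarrow> g x"
      using tendsto_uniform_limitI[OF g x] by (rule LIMSEQ_Suc)
    ultimately show "g x = qpoch_inf q x"
      unfolding lessThan_Suc_atMost by (rule LIMSEQ_unique[rotated])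
  qed auto
  finally show "\<exists>d>0. cball x0 d \<subseteq> UNIV \<and> uniform_limit (cball x0 d) ?f (qpoch_inf q) sequentially"
    by (intro exI[of _ 1]) auto
qed auto

lemma qpoch_inf_holomorphic:
  assumes "0 < q" "q < 1" "g holomorphic_on A"
  shows "(\<lambda>t. qpoch_inf q (g t)) holomorphic_on A"
  using holomorphic_on_compose_gen[OF assms(3) qpoch_inf_holomorphic_UNIV[OF assms(1,2)]]
  by (simp add: o_def)

lemma open_qregular:
  assumes q: "0 < q" "q < 1" and A: "open A" and g: "g holomorphic_on A"
  shows "open {t \<in> A. qregular q (g t)}"
proof -
  have "continuous_on A (\<lambda>t. qpoch_inf q (g t))"
    by (intro holomorphic_on_imp_continuous_on qpoch_inf_holomorphic q g)
  hence "open (A \<inter> (\<lambda>t. qpoch_inf q (g t)) -` (- {0}))"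
    using A by (rule continuous_open_preimage) auto
  also have "A \<inter> (\<lambda>t. qpoch_inf q (g t)) -` (- {0}) = {t \<in> A. qregular q (g t)}"
    using qpoch_inf_eq_0_iff[OF q] by auto
  finally show ?thesis .
qed

text \<open>Countable exceptional sets leave the plane connected, as the identity theorem requires.
  The variant below, with a power of \<open>t\<close> in the denominator, supplies the exceptional
  set for a continuity argument.\<close>

lemma countable_not_qregular_mult:
  "countable {t. \<not> qregular q (k * t)}"
proof (rule countable_subset)
  show "{t. \<not> qregular q (k * t)} \<subseteq> range (\<lambda>i::nat. 1 / (k * of_real q ^ i))"
  proof clarify
    fix t assume "\<not> qregular q (k * t)"
    then obtain i :: nat where "k * t * of_real q ^ i = 1" by (auto simp: qregular_def)
    hence "t * (k * of_real q ^ i) = 1" by (simp add: mult_ac)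
    moreover from this have "k * of_real q ^ i \<noteq> 0" by (metis mult_zero_right zero_neq_one)
    ultimately have "t = 1 / (k * of_real q ^ i)" by (metis nonzero_mult_div_cancel_right)
    thus "t \<in> range (\<lambda>i::nat. 1 / (k * of_real q ^ i))" by blast
  qed
qed simp

lemma countable_not_qregular_divide:
  assumes "n > 0"
  shows "countable {t. \<not> qregular q (k / t ^ n)}"
proof (rule countable_subset)
  show "{t. \<not> qregular q (k / t ^ n)} \<subseteq> (\<Union>i::nat. {t. t ^ n = k * of_real q ^ i})"
  proof clarify
    fix t assume "\<not> qregular q (k / t ^ n)"
    then obtain i :: nat where i: "k / t ^ n * of_real q ^ i = 1" by (auto simp: qregular_def)
    hence "t ^ n \<noteq> 0" by auto
    with i have "t ^ n = k * of_real q ^ i" by (simp add: field_simps)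
    thus "t \<in> (\<Union>i::nat. {t. t ^ n = k * of_real q ^ i})" by blast
  qed
  show "countable (\<Union>i::nat. {t::complex. t ^ n = k * of_real q ^ i})"
    by (rule countable_UN, simp, rule countable_finite, rule finite_nth_roots[OF assms])
qed

subsection \<open>Terminating very-well-poised series\<close>

definition lins :: "complex list \<Rightarrow> complex poly" where
  "lins xs = (\<Prod>x\<leftarrow>xs. [:1, - x:])"

text \<open>The quadratic factors of \<open>vwp_num\<close> and \<open>vwp_den\<close> encode the
  very-well-poised part without a square root: their quotient at \<open>q^k\<close> is
  \<open>(1 - a q^(2k+2)) / (1 - a q^(2k))\<close>, which telescopes in the product over
  \<open>k\<close>. The parameter \<open>q\<close> listed in \<open>vwp_den\<close> produces the
  zero at \<open>1/q\<close> on which the recurrence relies.\<close>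

definition vwp_num :: "real \<Rightarrow> complex \<Rightarrow> complex list \<Rightarrow> complex poly" where
  "vwp_num q a xs = [:1, 0, - (a * of_real q ^ 2):] * lins (a # xs)"

definition vwp_den :: "real \<Rightarrow> complex \<Rightarrow> complex list \<Rightarrow> complex poly" where
  "vwp_den q a ys = [:1, 0, - a:] * lins (of_real q # ys)"

lemma lins_simps [simp]: "lins [] = 1" "lins (x # xs) = [:1, - x:] * lins xs"
  by (simp_all add: lins_def)

lemma qpochs_simps [simp]: "qpochs q [] k = 1" "qpochs q (x # xs) k = qpoch q x k * qpochs q xs k"
  by (simp_all add: qpochs_def)

lemma prod_poly_lins: "(\<Prod>i<k. poly (lins xs) (of_real q ^ i)) = qpochs q xs k"
proof (induction xs)
  case (Cons x xs)
  have "poly (lins (x # xs)) s = (1 - x * s) * poly (lins xs) s" for s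
    by (simp add: algebra_simps)
  thus ?case using Cons by (simp only: prod.distrib qpoch_def qpochs_simps)
qed simp

lemma degree_lins: "degree (lins xs) \<le> length xs"
proof (induction xs)
  case (Cons x xs)
  have "degree (lins (x # xs)) \<le> degree [:1, - x:] + degree (lins xs)"
    unfolding lins_simps by (rule degree_mult_le)
  also have "\<dots> \<le> 1 + length xs" using Cons by (intro add_mono) auto
  finally show ?case by simp
qed simp

lemma degree_vwp_num: "degree (vwp_num q a xs) \<le> length xs + 3"
proof -
  have "degree (vwp_num q a xs) \<le> degree [:1, 0, - (a * of_real q ^ 2):] + degree (lins (a # xs))"
    unfolding vwp_num_def by (rule degree_mult_le)
  also have "\<dots> \<le> 2 + (length xs + 1)" using degree_lins[of "a # xs"] by (intro add_mono) auto
  finally show ?thesis by simp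
qed

lemma degree_vwp_den: "degree (vwp_den q a xs) \<le> length xs + 3"
proof -
  have "degree (vwp_den q a xs) \<le> degree [:1, 0, - a:] + degree (lins (of_real q # xs))"
    unfolding vwp_den_def by (rule degree_mult_le)
  also have "\<dots> \<le> 2 + (length xs + 1)" using degree_lins[of "of_real q # xs"] by (intro add_mono) auto
  finally show ?thesis by simp
qed

lemma coeff_lins_0 [simp]: "coeff (lins xs) 0 = 1"
  by (induction xs) (auto simp: coeff_mult)

lemma coeff_vwp_num_0 [simp]: "coeff (vwp_num q a xs) 0 = 1"
  by (simp add: vwp_num_def coeff_mult)

lemma coeff_vwp_den_0 [simp]: "coeff (vwp_den q a xs) 0 = 1"
  by (simp add: vwp_den_def coeff_mult)

lemma poly_lins_nonzero: "list_all (qregular q) xs \<Longrightarrow> poly (lins xs) (of_real q ^ k) \<noteq> 0"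
  by (induction xs) (auto dest: qregularD[of q _ k] simp: mult_ac)

lemma poly_vwp_den_nonzero:
  assumes q: "0 < q" "q < 1" and "qregular q a" "list_all (qregular q) ys"
  shows "poly (vwp_den q a ys) (of_real q ^ k) \<noteq> 0"
proof -
  have "poly (lins (of_real q # ys)) (of_real q ^ k) \<noteq> 0"
    by (rule poly_lins_nonzero) (use assms qregular_base[OF q] in auto)
  moreover have "poly [:1, 0, - a:] (of_real q ^ k) \<noteq> 0"
    using qregularD[OF assms(3), of "k + k"] by (simp add: power_add mult_ac)
  ultimately show ?thesis by (simp add: vwp_den_def)
qed

lemma poly_vwp_den_inverse: "q \<noteq> 0 \<Longrightarrow> poly (vwp_den q a ys) (1 / of_real q) = 0"
  by (simp add: vwp_den_def)

text \<open>The free factor \<open>p\<close> serves two purposes: \<open>p = 1\<close> gives the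
  ordinary series, and \<open>[:\<phi>, - 1:]\<close> replaces the last numerator parameter by its
  reciprocal.\<close>

lemma qh_term_vwp:
  assumes "qregular q a"
  shows "qh_term q (smult x (vwp_num q a xs * p)) (vwp_den q a ys) k =
     x ^ k * ((1 - a * of_real q ^ (2 * k)) / (1 - a)) * qpochs q (a # xs) k *
     (\<Prod>i<k. poly p (of_real q ^ i)) / qpochs q (of_real q # ys) k"
proof -
  let ?Q = "complex_of_real q"
  have nz: "1 - a * ?Q ^ (2 * k) \<noteq> 0" for k using qregularD[OF assms] .
  have tele: "(\<Prod>i<k. poly [:1, 0, - (a * ?Q ^ 2):] (?Q ^ i) / poly [:1, 0, - a:] (?Q ^ i)) =
     (1 - a * ?Q ^ (2 * k)) / (1 - a)"
  proof (induction k)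
    case 0
    show ?case using nz[of 0] by simp
  next
    case (Suc k)
    have "poly [:1, 0, - a:] (?Q ^ k) = 1 - a * ?Q ^ (2 * k)"
      by (simp add: mult_2 power_add)
    moreover have "poly [:1, 0, - (a * ?Q ^ 2):] (?Q ^ k) = 1 - a * ?Q ^ (2 * Suc k)"
      by (simp add: mult_2 power_add power2_eq_square)
    ultimately show ?case using Suc nz[of k] unfolding prod.lessThan_Suc by (simp only:) simp
  qed
  have "qh_term q (smult x (vwp_num q a xs * p)) (vwp_den q a ys) k =
    (\<Prod>i<k. x * (poly [:1, 0, - (a * ?Q ^ 2):] (?Q ^ i) / poly [:1, 0, - a:] (?Q ^ i)) *
     poly (lins (a # xs)) (?Q ^ i) * poly p (?Q ^ i) / poly (lins (?Q # ys)) (?Q ^ i))"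
    unfolding qh_term_def vwp_num_def vwp_den_def
    by (intro prod.cong refl) (simp only: poly_smult poly_mult times_divide_eq_left times_divide_eq_right divide_divide_eq_left mult_ac)
  also have "\<dots> = x ^ k * ((1 - a * ?Q ^ (2 * k)) / (1 - a)) * qpochs q (a # xs) k *
     (\<Prod>i<k. poly p (?Q ^ i)) / qpochs q (?Q # ys) k"
    unfolding prod.distrib prod_dividef tele[unfolded prod_dividef] prod_poly_lins by simp
  finally show ?thesis .
qed

text \<open>The first component of the unit Bailey pair after a Bailey step with
  \<open>b, c, u = aq/bc\<close> and another with \<open>d, e, v = aq/de\<close>.\<close>

definition watson_alpha where
  "watson_alpha q a b c d e u v r =
     qpoch q d r * qpoch q e r * v ^ r / (qpoch q (v * d) r * qpoch q (v * e) r) *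
     (qpoch q b r * qpoch q c r * u ^ r / (qpoch q (u * b) r * qpoch q (u * c) r) * unit_alpha q a r)"

text \<open>Two applications of the Bailey lemma to the unit Bailey pair give Watson's transformation. With the
  factors \<open>qpoch q v (n - j)\<close> left in the numerator, no condition on \<open>v = aq/de\<close> is needed.\<close>

lemma watson_bailey:
  assumes q: "0 < q" "q < 1" and a: "qregular q a"
    and u: "u * b * c = a * q" "qregular q (u * b)" "qregular q (u * c)"
    and v: "v * d * e = a * q" "qregular q (v * d)" "qregular q (v * e)"
  shows "qpoch q (v * d) n * qpoch q (v * e) n * bailey_beta q a (watson_alpha q a b c d e u v) n =
    (\<Sum>j\<le>n. qpoch q d j * qpoch q e j * qpoch q v (n - j) * v ^ j * qpoch q u j /
       (qpoch q q (n - j) * qpoch q q j * qpoch q (u * b) j * qpoch q (u * c) j))"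
proof -
  have aq: "qregular q (a * q)" using qregular_mult_power[OF a, of 1] by simp
  let ?\<alpha> = "\<lambda>r. qpoch q b r * qpoch q c r * u ^ r / (qpoch q (u * b) r * qpoch q (u * c) r) * unit_alpha q a r"
  have beta: "bailey_beta q a ?\<alpha> j = qpoch q u j / (qpoch q q j * qpoch q (u * b) j * qpoch q (u * c) j)" for j
  proof -
    have "qpoch q (u * b) j * qpoch q (u * c) j * bailey_beta q a ?\<alpha> j =
      (\<Sum>i\<le>j. qpoch q b i * qpoch q c i * qpoch q u (j - i) * u ^ i / qpoch q q (j - i) *
            bailey_beta q a (unit_alpha q a) i)"
      by (rule bailey_lemma[OF q aq u(2,3,1), symmetric])
    also have "\<dots> = (\<Sum>i\<le>j. if i = 0 then qpoch q u j / qpoch q q j else 0)"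
      by (intro sum.cong refl) (auto simp: bailey_beta_unit[OF q a])
    also have "\<dots> = qpoch q u j / qpoch q q j" by simp
    finally show ?thesis
      using qpoch_nonzero[OF u(2)] qpoch_nonzero[OF u(3)] qpoch_nonzero[OF qregular_base[OF q]]
      by (simp add: field_simps)
  qed
  have "qpoch q (v * d) n * qpoch q (v * e) n * bailey_beta q a (watson_alpha q a b c d e u v) n =
    (\<Sum>j\<le>n. qpoch q d j * qpoch q e j * qpoch q v (n - j) * v ^ j / qpoch q q (n - j) * bailey_beta q a ?\<alpha> j)"
    unfolding watson_alpha_def by (rule bailey_lemma[OF q aq v(2,3,1), symmetric])
  thus ?thesis unfolding beta by (simp add: mult_ac)
qed

text \<open>The right-hand side of Watson's transformation is symmetric in \<open>d\<close> and \<open>u = aq/bc\<close>.\<close>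

lemma bailey_beta_watson_transform:
  assumes q: "0 < q" "q < 1" and a: "qregular q a"
    and u: "u * b * c = a * q" "qregular q (u * b)" "qregular q (u * c)"
    and v: "v * d * e = a * q" "qregular q (v * d)" "qregular q (v * e)"
    and d: "d \<noteq> 0" and lam: "qregular q (a * u / d)" "qregular q (v * u)"
  shows "qpoch q (v * d) n * bailey_beta q a (watson_alpha q a b c d e u v) n =
    qpoch q (v * u) n * bailey_beta q (a * u / d) (watson_alpha q (a * u / d) (u * b / d) (u * c / d) u e d v) n"
proof -
  \<comment> \<open>For the base \<open>au/d\<close> and the parameters \<open>ub/d\<close>,
    \<open>uc/d\<close>, the quantity that plays the part of \<open>u\<close> is \<open>d\<close>.
    Thus \<open>u\<close> and \<open>d\<close> change places, while \<open>e\<close> and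
    \<open>v\<close> stay.\<close>
  have ubc: "d * (u * b / d) * (u * c / d) = a * u / d * q"
    using u(1) d by (simp add: field_simps)
  have vue: "v * u * e = a * u / d * q"
    using v(1) d by (simp add: field_simps)
  have "qpoch q (v * u) n * qpoch q (v * e) n * bailey_beta q (a * u / d)
     (watson_alpha q (a * u / d) (u * b / d) (u * c / d) u e d v) n =
    (\<Sum>j\<le>n. qpoch q u j * qpoch q e j * qpoch q v (n - j) * v ^ j * qpoch q d j /
       (qpoch q q (n - j) * qpoch q q j * qpoch q (d * (u * b / d)) j * qpoch q (d * (u * c / d)) j))"
    by (rule watson_bailey[OF q lam(1) ubc _ _ vue lam(2) v(3)]) (use u d in auto)
  also have "\<dots> = qpoch q (v * d) n * qpoch q (v * e) n * bailey_beta q a (watson_alpha q a b c d e u v) n"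
    unfolding watson_bailey[OF q a u v] using d by (intro sum.cong refl) (simp add: mult_ac)
  finally show ?thesis using qpoch_nonzero[OF v(3), of n] by simp
qed

text \<open>The product is \<open>q^(nk) (q^(-n);q)_k\<close>, the numerator factor of the last
  parameter after \<open>q^n\<close> has been absorbed into it.\<close>

lemma prod_power_diff:
  "k \<le> n \<Longrightarrow> (\<Prod>i<k. complex_of_real q ^ n - of_real q ^ i) * qpoch q q (n - k) =
     (-1) ^ k * of_real q ^ (\<Sum>{..<k}) * qpoch q q n"
proof (induction k)
  case (Suc k)
  then obtain p where p: "n = Suc k + p" by (metis le_Suc_ex)
  let ?P = "\<Prod>i<k. complex_of_real q ^ n - of_real q ^ i"
  have nk: "n - k = Suc p" "n - Suc k = p" using p by auto
  have "?P * (qpoch q q p * (1 - of_real q * of_real q ^ p)) =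
     (-1) ^ k * of_real q ^ (\<Sum>{..<k}) * qpoch q q n"
    using Suc unfolding nk qpoch_Suc by simp
  moreover have "complex_of_real q ^ n - of_real q ^ k = - (of_real q ^ k) * (1 - of_real q * of_real q ^ p)"
    by (simp add: p power_add algebra_simps)
  ultimately show ?case unfolding nk
    by (simp add: power_add) (simp add: mult_ac)
qed simp

text \<open>Here \<open>\<phi>\<close> is the reciprocal of the last parameter \<open>f\<close>. The argument of the series is \<open>u v \<phi>\<close>, and
  its factor \<open>\<phi>\<close> is absorbed into \<open>1 - f q\<^sup>k\<close>, which makes the point \<open>f = \<infinity>\<close> regular.\<close>

definition vwp_phi where
  "vwp_phi q a b c d e u v \<phi> =
    qh q (smult (u * v) (vwp_num q a [b, c, d, e] * [:\<phi>, - 1:]))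
      (vwp_den q a [u * c, u * b, v * e, v * d, a * of_real q * \<phi>])"

text \<open>At \<open>\<phi> = q^n\<close> the factor \<open>\<phi> - q^k\<close> vanishes for
  \<open>k = n\<close> and cuts the series off, and the denominator parameter
  \<open>a q \<phi>\<close> supplies the \<open>qpoch q (a * q) (n + k)\<close> of the Bailey
  sum.\<close>

lemma vwp_phi_terminating:
  assumes q: "0 < q" "q < 1" and a: "qregular q a"
    and u: "qregular q (u * b)" "qregular q (u * c)"
    and v: "qregular q (v * d)" "qregular q (v * e)"
    and uv: "qregular q (u * v * of_real q ^ n)"
  shows "vwp_phi q a b c d e u v (of_real q ^ n) =
     qpoch q q n * qpoch q (a * q) n * bailey_beta q a (watson_alpha q a b c d e u v) n"
proof -
  let ?Q = "complex_of_real q"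
  let ?N = "smult (u * v) (vwp_num q a [b, c, d, e] * [:?Q ^ n, - 1:])"
  let ?D = "vwp_den q a [u * c, u * b, v * e, v * d, a * ?Q * ?Q ^ n]"
  have aq: "qregular q (a * ?Q)" using qregular_mult_power[OF a, of 1] by simp
  note nz = qpoch_nonzero[OF qregular_base[OF q]] qpoch_nonzero[OF aq]
  have aqn: "qregular q (a * ?Q * ?Q ^ n)" by (rule qregular_mult_power[OF aq])
  note t = qh_term_vwp[OF a, of "u * v" "[b, c, d, e]" "[:?Q ^ n, - 1:]" "[u * c, u * b, v * e, v * d, a * ?Q * ?Q ^ n]"]
  have t0: "qh_term q ?N ?D k = 0" if "k > n" for k
  proof -
    have "(\<Prod>i<k. poly [:?Q ^ n, - 1:] (?Q ^ i)) = 0"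
      using that by (intro prod_zero) auto
    thus ?thesis unfolding t by simp
  qed
  have "vwp_phi q a b c d e u v (?Q ^ n) = (\<Sum>k. qh_term q ?N ?D k)"
    unfolding vwp_phi_def
  proof (rule qh_eq_sum[OF q])
    show "summable (qh_term q ?N ?D)"
      by (rule summable_finite[of "{..n}"]) (use t0 in auto)
    show "poly ?D (?Q ^ k) \<noteq> 0" for k
      by (rule poly_vwp_den_nonzero[OF q a]) (use u v aqn in auto)
    show "coeff ?N 0 * ?Q ^ k \<noteq> 1" for k
      using uv by (auto simp: qregular_def coeff_mult mult_ac)
  qed (use q poly_vwp_den_inverse in auto)
  also have "\<dots> = (\<Sum>k\<le>n. qh_term q ?N ?D k)"
    by (rule suminf_finite) (use t0 in auto)
  also have "\<dots> = qpoch q q n * qpoch q (a * q) n * bailey_beta q a (watson_alpha q a b c d e u v) n"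
    unfolding bailey_beta_def sum_distrib_left
  proof (rule sum.cong[OF refl])
    fix k assume "k \<in> {..n}"
    hence k: "k \<le> n" by simp
    have "(\<Prod>i<k. poly [:?Q ^ n, - 1:] (?Q ^ i)) = (\<Prod>i<k. ?Q ^ n - ?Q ^ i)" by simp
    also have "\<dots> = (-1) ^ k * ?Q ^ (\<Sum>{..<k}) * qpoch q q n / qpoch q q (n - k)"
      using prod_power_diff[OF k, of q] nz by (simp add: eq_divide_eq)
    finally have p: "(\<Prod>i<k. poly [:?Q ^ n, - 1:] (?Q ^ i)) =
      (-1) ^ k * ?Q ^ (\<Sum>{..<k}) * qpoch q q n / qpoch q q (n - k)" .
    have e: "qpoch q (a * ?Q * ?Q ^ n) k = qpoch q (a * ?Q) (n + k) / qpoch q (a * ?Q) n"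
      using nz by (simp add: qpoch_add)
    show "qh_term q ?N ?D k = qpoch q q n * qpoch q (a * q) n * (watson_alpha q a b c d e u v k /
       (qpoch q q (n - k) * qpoch q (a * q) (n + k)))"
      unfolding t p watson_alpha_def unit_alpha_def qpochs_simps e power_mult_distrib
      by (simp only: times_divide_eq_left times_divide_eq_right divide_divide_eq_left divide_divide_eq_right mult_1_right mult_1_left mult_ac)
  qed
  finally show ?thesis .
qed

subsection \<open>Transformations of nonterminating series\<close>

lemma holomorphic_coeff_mult:
  assumes "\<And>j. (\<lambda>t. coeff (P t) j) holomorphic_on A" "\<And>j. (\<lambda>t. coeff (R t) j) holomorphic_on A"
  shows "(\<lambda>t. coeff (P t * R t) j) holomorphic_on A"
  unfolding coeff_mult by (intro holomorphic_intros assms)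

lemma holomorphic_coeff_smult:
  assumes "f holomorphic_on A" "\<And>j. (\<lambda>t. coeff (P t) j) holomorphic_on A"
  shows "(\<lambda>t. coeff (smult (f t) (P t)) j) holomorphic_on A"
  unfolding coeff_smult by (intro holomorphic_intros assms)

lemma holomorphic_coeff_pCons:
  assumes "f holomorphic_on A" "\<And>j. (\<lambda>t. coeff (P t) j) holomorphic_on A"
  shows "(\<lambda>t. coeff (pCons (f t) (P t)) j) holomorphic_on A"
  using assms by (cases j) auto

lemmas holomorphic_coeff_intros =
  holomorphic_coeff_mult holomorphic_coeff_smult holomorphic_coeff_pCons

lemma holomorphic_coeff_lins:
  assumes "\<And>f. f \<in> set fs \<Longrightarrow> f holomorphic_on A"
  shows "(\<lambda>t. coeff (lins (map (\<lambda>f. f t) fs)) j) holomorphic_on A"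
  using assms
proof (induction fs arbitrary: j)
  case (Cons f fs)
  thus ?case unfolding list.map lins_simps
    by (intro holomorphic_coeff_intros holomorphic_intros) auto
qed auto

lemma vwp_phi_holomorphic:
  assumes q: "0 < q" "q < 1" and a: "qregular q a"
    and u: "qregular q (u * b)" "qregular q (u * c)"
    and v: "qregular q (v * d)" "qregular q (v * e)"
    and A: "open A" "\<And>\<phi>. \<phi> \<in> A \<Longrightarrow> qregular q (a * q * \<phi>)" "\<And>\<phi>. \<phi> \<in> A \<Longrightarrow> qregular q (u * v * \<phi>)"
  shows "vwp_phi q a b c d e u v holomorphic_on A"
proof -
  let ?Q = "complex_of_real q"
  have "(\<lambda>\<phi>. qh q (smult (u * v) (vwp_num q a [b, c, d, e] * [:\<phi>, - 1:]))
      (vwp_den q a [u * c, u * b, v * e, v * d, a * of_real q * \<phi>])) holomorphic_on A"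
  proof (rule qh_holomorphic[OF q A(1)])
    show "(\<lambda>\<phi>. coeff (smult (u * v) (vwp_num q a [b, c, d, e] * [:\<phi>, - 1:])) j) holomorphic_on A" for j
      by (intro holomorphic_coeff_intros holomorphic_intros)
    show "(\<lambda>\<phi>. coeff (vwp_den q a [u * c, u * b, v * e, v * d, a * of_real q * \<phi>]) j) holomorphic_on A" for j
      unfolding vwp_den_def lins_simps
      by (intro holomorphic_coeff_intros holomorphic_intros)
    show "degree (smult (u * v) (vwp_num q a [b, c, d, e] * [:\<phi>, - 1:])) \<le> 8" for \<phi>
    proof -
      have "degree (vwp_num q a [b, c, d, e] * [:\<phi>, - 1:]) \<le> degree (vwp_num q a [b, c, d, e]) + degree [:\<phi>, - 1:]"
        by (rule degree_mult_le)
      also have "\<dots> \<le> 7 + 1" using degree_vwp_num[of q a "[b, c, d, e]"] by (intro add_mono) auto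
      finally show ?thesis by (auto intro: order.trans[OF degree_smult_le])
    qed
    show "degree (vwp_den q a [u * c, u * b, v * e, v * d, a * of_real q * \<phi>]) \<le> 8" for \<phi>
      using degree_vwp_den[of q a "[u * c, u * b, v * e, v * d, a * of_real q * \<phi>]"] by simp
    show "poly (vwp_den q a [u * c, u * b, v * e, v * d, a * of_real q * \<phi>]) (of_real q ^ k) \<noteq> 0"
      if "\<phi> \<in> A" for \<phi> k
      by (rule poly_vwp_den_nonzero[OF q a]) (use u v A(2)[OF that] in auto)
    show "coeff (smult (u * v) (vwp_num q a [b, c, d, e] * [:\<phi>, - 1:])) 0 * of_real q ^ k \<noteq> 1"
      if "\<phi> \<in> A" for \<phi> k
      using A(3)[OF that] by (auto simp: qregular_def coeff_mult)
  qed (use q in \<open>auto simp: poly_vwp_den_inverse\<close>)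
  thus ?thesis by (simp add: vwp_phi_def[abs_def])
qed

lemma connected_Compl_countable:
  fixes T :: "complex set"
  assumes "countable T"
  shows "connected (- T)"
  using connected_open_diff_countable[of "UNIV :: complex set" T, OF _ open_UNIV connected_UNIV assms]
  by (simp add: Compl_eq_Diff_UNIV)

lemma vwp_phi_transform:
  fixes a b c d e u v \<phi> :: complex and q :: real
  defines "l \<equiv> a * u / d"
  assumes q: "0 < q" "q < 1" and a: "qregular q a"
    and u: "u * b * c = a * q" "qregular q (u * b)" "qregular q (u * c)"
    and v: "v * d * e = a * q" "qregular q (v * d)" "qregular q (v * e)"
    and d: "d \<noteq> 0" and l: "qregular q l" "qregular q (v * u)"
    and \<phi>: "qregular q (a * q * \<phi>)" "qregular q (u * v * \<phi>)" "qregular q (l * q * \<phi>)" "qregular q (v * d * \<phi>)"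
  shows "qpoch_inf q (v * d) * qpoch_inf q (a * q * \<phi>) * qpoch_inf q (l * q) * qpoch_inf q (u * v * \<phi>) *
           vwp_phi q a b c d e u v \<phi> =
         qpoch_inf q (a * q) * qpoch_inf q (v * d * \<phi>) * qpoch_inf q (v * u) * qpoch_inf q (l * q * \<phi>) *
           vwp_phi q l (u * b / d) (u * c / d) u e d v \<phi>"
proof -
  let ?Q = "complex_of_real q"
  define f where "f \<phi> = qpoch_inf q (v * d) * qpoch_inf q (a * q * \<phi>) * qpoch_inf q (l * q) *
           qpoch_inf q (u * v * \<phi>) * vwp_phi q a b c d e u v \<phi> -
         qpoch_inf q (a * q) * qpoch_inf q (v * d * \<phi>) * qpoch_inf q (v * u) * qpoch_inf q (l * q * \<phi>) *
           vwp_phi q l (u * b / d) (u * c / d) u e d v \<phi>" for \<phi>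
  \<comment> \<open>\<open>S\<close> omits only countably many points and contains 0, the limit of
    the interpolation points \<open>q^n\<close>.\<close>
  define S where "S = {\<phi>. qpoch_inf q (a * q * \<phi>) * qpoch_inf q (u * v * \<phi>) *
    qpoch_inf q (l * q * \<phi>) * qpoch_inf q (v * d * \<phi>) \<noteq> 0}"
  have S_iff: "\<phi> \<in> S \<longleftrightarrow> qregular q (a * q * \<phi>) \<and> qregular q (u * v * \<phi>) \<and>
      qregular q (l * q * \<phi>) \<and> qregular q (v * d * \<phi>)" for \<phi>
    by (auto simp: S_def qpoch_inf_eq_0_iff[OF q])
  have S: "open S"
  proof -
    have "continuous_on UNIV (\<lambda>\<phi>. qpoch_inf q (a * q * \<phi>) * qpoch_inf q (u * v * \<phi>) *
      qpoch_inf q (l * q * \<phi>) * qpoch_inf q (v * d * \<phi>))"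
      by (intro holomorphic_on_imp_continuous_on holomorphic_intros qpoch_inf_holomorphic q)
    from open_Collect_neq[OF this continuous_on_const] show ?thesis unfolding S_def .
  qed
  have "connected (- ({\<phi>. \<not> qregular q (a * q * \<phi>)} \<union> {\<phi>. \<not> qregular q (u * v * \<phi>)} \<union>
       {\<phi>. \<not> qregular q (l * q * \<phi>)} \<union> {\<phi>. \<not> qregular q (v * d * \<phi>)}))"
    by (intro connected_Compl_countable countable_Un countable_not_qregular_mult)
  also have "- ({\<phi>. \<not> qregular q (a * q * \<phi>)} \<union> {\<phi>. \<not> qregular q (u * v * \<phi>)} \<union>
       {\<phi>. \<not> qregular q (l * q * \<phi>)} \<union> {\<phi>. \<not> qregular q (v * d * \<phi>)}) = S"
    using S_iff by blast
  finally have conn: "connected S" .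
  have S0: "0 \<in> S" by (simp add: S_def)
  have dd: "d * (u * b / d) = u * b" "d * (u * c / d) = u * c" using d by auto
  have hol: "f holomorphic_on S"
    unfolding f_def
  proof (intro holomorphic_intros qpoch_inf_holomorphic q)
    show "vwp_phi q a b c d e u v holomorphic_on S"
      by (rule vwp_phi_holomorphic[OF q a u(2,3) v(2,3) S]) (auto simp: S_iff)
    show "vwp_phi q l (u * b / d) (u * c / d) u e d v holomorphic_on S"
      by (rule vwp_phi_holomorphic[OF q l(1) _ _ l(2) v(3) S]) (unfold dd, use u in \<open>simp_all only: S_iff mult_ac\<close>)
  qed
  have zero: "f (?Q ^ n) = 0" if n: "?Q ^ n \<in> S" for n
  proof -
    have n': "qregular q (u * v * ?Q ^ n)" "qregular q (d * v * ?Q ^ n)"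
      using n by (auto simp: S_iff mult_ac)
    have V: "vwp_phi q a b c d e u v (?Q ^ n) =
       qpoch q q n * qpoch q (a * q) n * bailey_beta q a (watson_alpha q a b c d e u v) n"
      by (rule vwp_phi_terminating[OF q a u(2,3) v(2,3) n'(1)])
    have V': "vwp_phi q l (u * b / d) (u * c / d) u e d v (?Q ^ n) =
       qpoch q q n * qpoch q (l * q) n * bailey_beta q l (watson_alpha q l (u * b / d) (u * c / d) u e d v) n"
      by (rule vwp_phi_terminating[OF q l(1) _ _ l(2) v(3) n'(2)]) (unfold dd, use u in auto)
    have T: "qpoch q (v * d) n * bailey_beta q a (watson_alpha q a b c d e u v) n =
      qpoch q (v * u) n * bailey_beta q l (watson_alpha q l (u * b / d) (u * c / d) u e d v) n"
      using bailey_beta_watson_transform[OF q a u v d] l by (simp add: l_def)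
    have vu: "u * v * ?Q ^ n = v * u * ?Q ^ n" by simp
    \<comment> \<open>Each infinite product without \<open>\<phi>\<close> is split after
      \<open>n\<close> factors, and its tail is the corresponding product with
      \<open>\<phi> = q^n\<close>. What remains is the finite identity \<open>T\<close>.\<close>
    show ?thesis
      unfolding f_def V V' vu
      using T
      unfolding qpoch_inf_split[OF q, of "v * d" n] qpoch_inf_split[OF q, of "a * ?Q" n]
        qpoch_inf_split[OF q, of "l * ?Q" n] qpoch_inf_split[OF q, of "v * u" n]
      by algebra
  qed
  have lim: "0 islimpt (range (\<lambda>n. ?Q ^ n) \<inter> S)"
    unfolding islimpt_approachable
  proof (intro allI impI)
    fix \<epsilon> :: real assume \<epsilon>: "\<epsilon> > 0"
    have Q: "(\<lambda>n. ?Q ^ n) \<longlonglongrightarrow> 0" using q by (intro LIMSEQ_power_zero) auto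
    have "eventually (\<lambda>n. ?Q ^ n \<in> S) sequentially"
      using Q S S0 by (rule topological_tendstoD)
    moreover have "eventually (\<lambda>n. dist (?Q ^ n) 0 < \<epsilon>) sequentially"
      using Q \<epsilon> by (rule tendstoD)
    ultimately have "eventually (\<lambda>n. ?Q ^ n \<in> S \<and> dist (?Q ^ n) 0 < \<epsilon>) sequentially"
      by eventually_elim auto
    then obtain n where "?Q ^ n \<in> S" "dist (?Q ^ n) 0 < \<epsilon>"
      by (auto simp: eventually_sequentially)
    thus "\<exists>x'\<in>range (\<lambda>n. ?Q ^ n) \<inter> S. x' \<noteq> 0 \<and> dist x' 0 < \<epsilon>"
      using q by (intro bexI[of _ "?Q ^ n"]) auto
  qed
  have "f \<phi> = 0"
    by (rule analytic_continuation[OF hol S conn _ S0 lim]) (use zero \<phi> in \<open>auto simp: S_iff\<close>)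
  thus ?thesis by (simp add: f_def)
qed

section \<open>The two transformations in terms of symmetric parameter lists\<close>

definition vwp :: "real \<Rightarrow> complex \<Rightarrow> complex list \<Rightarrow> complex \<Rightarrow> complex" where
  "vwp q a xs x = qh q (smult x (vwp_num q a xs)) (vwp_den q a (map (\<lambda>b. a * of_real q / b) xs))"

lemma lins_mset_eq: "mset xs = mset ys \<Longrightarrow> lins xs = lins ys"
  unfolding lins_def by (metis mset_map prod_mset_prod_list)

lemma vwp_permute:
  assumes "mset xs = mset ys"
  shows "vwp q a xs x = vwp q a ys x"
proof -
  have "lins (map (\<lambda>b. a * of_real q / b) xs) = lins (map (\<lambda>b. a * of_real q / b) ys)"
    using assms by (intro lins_mset_eq) simp
  thus ?thesis
    using lins_mset_eq[OF assms] by (simp add: vwp_def vwp_num_def vwp_den_def)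
qed

lemma vwp_eq_vwp_phi:
  assumes "b \<noteq> 0" "c \<noteq> 0" "d \<noteq> 0" "e \<noteq> 0" "f \<noteq> 0"
    and u: "u * b * c = a * of_real q" and v: "v * d * e = a * of_real q"
    and x: "x * f = u * v"
  shows "vwp q a [b, c, d, e, f] x = vwp_phi q a b c d e u v (1 / f)"
proof -
  have l: "map (\<lambda>b. a * complex_of_real q / b) [b, c, d, e, f] = [u * c, u * b, v * e, v * d, a * of_real q * (1 / f)]"
    using assms by (simp add: field_simps)
  have "[:1 / f, - 1:] = smult (1 / f) [:1, - f:]" using assms by simp
  moreover have "vwp_num q a [b, c, d, e, f] = vwp_num q a [b, c, d, e] * [:1, - f:]"
    by (simp only: vwp_num_def lins_simps mult_1_right mult_ac)
  ultimately have "smult (u * v) (vwp_num q a [b, c, d, e] * [:1 / f, - 1:]) =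
      smult (u * v / f) (vwp_num q a [b, c, d, e, f])"
    by (simp only: mult_smult_right smult_smult) simp
  moreover have "u * v / f = x" using x assms by (simp add: field_simps)
  ultimately show ?thesis unfolding vwp_def vwp_phi_def l by simp
qed

text \<open>Gasper and Rahman, (III.23).\<close>

lemma vwp_transform:
  assumes q: "0 < q" "q < 1" and a: "a \<noteq> 0" "qregular q a"
    and nz: "b \<noteq> 0" "c \<noteq> 0" "d \<noteq> 0" "e \<noteq> 0" "f \<noteq> 0"
    and x: "x * (b * c * d * e * f) = a ^ 2 * of_real q ^ 2" 
    and l: "l * (b * c * d) = a ^ 2 * of_real q"
    and reg: "qregular q (a * q / b)" "qregular q (a * q / c)" "qregular q (a * q / d)" 
      "qregular q (a * q / e)" "qregular q (a * q / f)" "qregular q x"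
    and reg': "qregular q l" "qregular q (l * q / e)" "qregular q (l * q / f)" "qregular q (a * q / (e * f))"
  shows "qpoch_inf q (a * q / e) * qpoch_inf q (a * q / f) * qpoch_inf q (l * q) * qpoch_inf q x *
           vwp q a [b, c, d, e, f] x =
         qpoch_inf q (a * q) * qpoch_inf q (a * q / (e * f)) * qpoch_inf q (l * q / e) * qpoch_inf q (l * q / f) *
           vwp q l [l * b / a, l * c / a, l * d / a, e, f] (a * q / (e * f))"
proof -
  let ?Q = "complex_of_real q"
  have Q: "?Q \<noteq> 0" using q by simp
  define u v where "u = a * ?Q / (b * c)" and "v = a * ?Q / (d * e)"
  have u: "u * b * c = a * ?Q" and v: "v * d * e = a * ?Q"
    using nz by (simp_all add: u_def v_def)
  have ub: "u * b = a * ?Q / c" "u * c = a * ?Q / b" "v * d = a * ?Q / e" "v * e = a * ?Q / d"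
    using nz by (simp_all add: u_def v_def)
  have l_eq: "l = a * u / d"
    using l nz by (simp add: u_def field_simps power2_eq_square)
  have x_eq: "x = u * v * (1 / f)"
    using x nz by (simp add: u_def v_def eq_divide_eq power2_eq_square mult_ac)
  have vu: "v * u = l * ?Q / e" using nz by (simp add: u_def v_def l_eq mult_ac)
  have l': "l * b / a = u * b / d" "l * c / a = u * c / d" "l * d / a = u"
    using nz a by (simp_all add: l_eq)
  have u0: "u \<noteq> 0" using nz a Q by (simp add: u_def)
  have ef: "a * ?Q / (e * f) = v * d * (1 / f)" using nz by (simp add: v_def)
  have lf: "l * ?Q / f = l * ?Q * (1 / f)" "a * ?Q / f = a * ?Q * (1 / f)" by simp_all
  have W: "vwp q a [b, c, d, e, f] x = vwp_phi q a b c d e u v (1 / f)"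
    by (rule vwp_eq_vwp_phi[OF nz u v]) (use nz in \<open>simp add: x_eq\<close>)
  have W': "vwp q l [u * b / d, u * c / d, u, e, f] (a * ?Q / (e * f)) =
      vwp_phi q l (u * b / d) (u * c / d) u e d v (1 / f)"
  proof (rule vwp_eq_vwp_phi)
    show "d * (u * b / d) * (u * c / d) = l * ?Q" "v * u * e = l * ?Q"
      using u v nz by (simp_all add: l_eq field_simps)
    show "a * ?Q / (e * f) * f = d * v" using nz by (simp add: v_def)
  qed (use nz u0 in auto)
  show ?thesis
    unfolding l' W W' unfolding ef lf x_eq vu[symmetric] unfolding ub(3)[symmetric] unfolding l_eq
    by (rule vwp_phi_transform[OF q a(2) u _ _ v])
       (use reg reg' nz in \<open>simp_all only: ub ef lf x_eq vu flip: l_eq, (simp_all only: flip: vu ub ef lf x_eq)?\<close>)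
qed


text \<open>The first application of \<open>vwp_transform\<close> singles out \<open>c, d, e\<close>
  and has the new base \<open>l = a^2 q/(cde)\<close>. The second singles out
  \<open>l e/a, b, f\<close>; its new base is \<open>m\<close>, and its new argument
  \<open>l q / ((l c/a)(l d/a))\<close> equals \<open>e\<close>. The assumptions \<open>regl\<close>
  concern the series in between, with argument \<open>aq/(bf)\<close>; they make the factors common
  to both identities cancellable.\<close>

lemma vwp_two_term_nondegenerate:
  assumes q: "0 < q" "q < 1" and a: "a \<noteq> 0" "qregular q a"
    and nz: "b \<noteq> 0" "c \<noteq> 0" "d \<noteq> 0" "e \<noteq> 0" "f \<noteq> 0"
    and x: "x * (b * c * d * e * f) = a ^ 2 * of_real q ^ 2"
    and m: "m = a * x / e"
    and l: "l * (c * d * e) = a ^ 2 * of_real q"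
    and reg: "qregular q (a * q / b)" "qregular q (a * q / c)" "qregular q (a * q / d)"
      "qregular q (a * q / e)" "qregular q (a * q / f)" "qregular q x"
    and reg': "qregular q m" "qregular q e"
      "qregular q (b * x)" "qregular q (c * x)" "qregular q (d * x)" "qregular q (f * x)"
    and regl: "qregular q l" "qregular q (l * q / b)" "qregular q (l * q / f)" "qregular q (a * q / (b * f))"
  shows "qpoch_inf q (a * q / b) * qpoch_inf q (a * q / c) * qpoch_inf q (a * q / d) * qpoch_inf q (a * q / f) *
           qpoch_inf q (m * q) * qpoch_inf q x * vwp q a [b, c, d, e, f] x =
         qpoch_inf q (a * q) * qpoch_inf q e * qpoch_inf q (b * x) * qpoch_inf q (c * x) *
           qpoch_inf q (d * x) * qpoch_inf q (f * x) *
           vwp q m [x, a * q / (b * e), a * q / (c * e), a * q / (d * e), a * q / (e * f)] e"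
proof -
  let ?Q = "complex_of_real q"
  have Q: "?Q \<noteq> 0" using q by simp
  have l0: "l \<noteq> 0" using l a Q by auto
  have l_eq: "l = a ^ 2 * ?Q / (c * d * e)" using l nz by (simp add: eq_divide_eq)
  have x_eq: "x = a ^ 2 * ?Q ^ 2 / (b * c * d * e * f)" using x nz by (simp add: eq_divide_eq)
  have x0: "x \<noteq> 0" using a Q nz by (simp add: x_eq)
  note simps = l_eq x_eq m power2_eq_square divide_simps
  have e1: "l * ?Q / b = f * x" "l * ?Q / f = b * x"
    using nz a Q by (simp_all add: simps)
  have p1: "vwp q a [c, d, e, b, f] x = vwp q a [b, c, d, e, f] x"
    by (rule vwp_permute) simp
  have p2: "vwp q l [l * c / a, l * d / a, l * e / a, b, f] y =
      vwp q l [l * e / a, b, f, l * c / a, l * d / a] y" for y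
    by (rule vwp_permute) simp
  have "qpoch_inf q (a * q / b) * qpoch_inf q (a * q / f) * qpoch_inf q (l * q) * qpoch_inf q x *
           vwp q a [c, d, e, b, f] x =
         qpoch_inf q (a * q) * qpoch_inf q (a * q / (b * f)) * qpoch_inf q (l * q / b) * qpoch_inf q (l * q / f) *
           vwp q l [l * c / a, l * d / a, l * e / a, b, f] (a * q / (b * f))"
    by (rule vwp_transform[OF q a nz(2,3,4,1,5) _ l reg(2,3,4,1,5,6) regl])
       (use x in \<open>simp add: mult_ac\<close>)
  hence first: "qpoch_inf q (a * q / b) * qpoch_inf q (a * q / f) * qpoch_inf q (l * q) * qpoch_inf q x *
           vwp q a [b, c, d, e, f] x =
         qpoch_inf q (a * q) * qpoch_inf q (a * q / (b * f)) * qpoch_inf q (f * x) * qpoch_inf q (b * x) *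
           vwp q l [l * e / a, b, f, l * c / a, l * d / a] (a * q / (b * f))"
    unfolding e1 p1 p2 .
  have e2: "l * ?Q / (l * c / a) = a * ?Q / c" "l * ?Q / (l * d / a) = a * ?Q / d"
    "l * ?Q / (l * e / a) = a * ?Q / e"
    using l0 nz a by (simp_all add: divide_simps)
  have e3: "l * ?Q / (l * c / a * (l * d / a)) = e" 
    using l0 nz a Q by (simp add: divide_simps) (simp add: l_eq power2_eq_square)
  have e4: "m * ?Q / (l * c / a) = d * x" "m * ?Q / (l * d / a) = c * x"
    using nz a Q by (simp_all add: simps)
  have e5: "m * (l * e / a) / l = x" "m * b / l = a * ?Q / (e * f)" "m * f / l = a * ?Q / (b * e)"
    "l * c / a = a * ?Q / (d * e)" "l * d / a = a * ?Q / (c * e)"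
    using nz a Q by (simp_all add: simps)
  have "qpoch_inf q (l * q / (l * c / a)) * qpoch_inf q (l * q / (l * d / a)) * qpoch_inf q (m * q) *
           qpoch_inf q (a * q / (b * f)) * vwp q l [l * e / a, b, f, l * c / a, l * d / a] (a * q / (b * f)) =
         qpoch_inf q (l * q) * qpoch_inf q (l * q / (l * c / a * (l * d / a))) *
           qpoch_inf q (m * q / (l * c / a)) * qpoch_inf q (m * q / (l * d / a)) *
           vwp q m [m * (l * e / a) / l, m * b / l, m * f / l, l * c / a, l * d / a]
             (l * q / (l * c / a * (l * d / a)))"
  proof (rule vwp_transform[OF q l0 regl(1)])
    show "a * ?Q / (b * f) * (l * e / a * b * f * (l * c / a) * (l * d / a)) = l ^ 2 * ?Q ^ 2"
      using nz a by (simp add: divide_simps) (use l in algebra)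
    show "m * (l * e / a * b * f) = l ^ 2 * ?Q"
      using nz a Q by (simp add: simps)
  qed (unfold e2 e3 e4, use l0 nz a reg reg' regl in auto)
  hence second: "qpoch_inf q (a * q / c) * qpoch_inf q (a * q / d) * qpoch_inf q (m * q) *
           qpoch_inf q (a * q / (b * f)) * vwp q l [l * e / a, b, f, l * c / a, l * d / a] (a * q / (b * f)) =
         qpoch_inf q (l * q) * qpoch_inf q e * qpoch_inf q (d * x) * qpoch_inf q (c * x) *
           vwp q m [x, a * q / (e * f), a * q / (b * e), a * q / (d * e), a * q / (c * e)] e"
    unfolding e2 e3 e4 unfolding e5 .
  have perm: "vwp q m [x, a * q / (e * f), a * q / (b * e), a * q / (d * e), a * q / (c * e)] e =
     vwp q m [x, a * q / (b * e), a * q / (c * e), a * q / (d * e), a * q / (e * f)] e"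
    by (rule vwp_permute) simp
  have lq: "qregular q (l * ?Q)" using qregular_mult_power[OF regl(1), of 1] by simp
  have n: "qpoch_inf q (l * ?Q) \<noteq> 0" "qpoch_inf q (a * ?Q / (b * f)) \<noteq> 0"
    using lq regl qpoch_inf_eq_0_iff[OF q] by auto
  have "(qpoch_inf q (l * ?Q) * qpoch_inf q (a * ?Q / (b * f))) *
      (qpoch_inf q (a * q / b) * qpoch_inf q (a * q / c) * qpoch_inf q (a * q / d) * qpoch_inf q (a * q / f) *
           qpoch_inf q (m * q) * qpoch_inf q x * vwp q a [b, c, d, e, f] x) =
     (qpoch_inf q (l * ?Q) * qpoch_inf q (a * ?Q / (b * f))) *
      (qpoch_inf q (a * q) * qpoch_inf q e * qpoch_inf q (b * x) * qpoch_inf q (c * x) *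
           qpoch_inf q (d * x) * qpoch_inf q (f * x) *
           vwp q m [x, a * q / (e * f), a * q / (b * e), a * q / (d * e), a * q / (c * e)] e)"
    using first second by algebra
  thus ?thesis using n unfolding perm by simp
qed

section \<open>Removing the conditions on the intermediate series\<close>

lemma vwp_holomorphic:
  assumes q: "0 < q" "q < 1" and A: "open A"
    and hol: "g holomorphic_on A" "\<And>f. f \<in> set fs \<Longrightarrow> f holomorphic_on A" "h holomorphic_on A"
    and nz: "\<And>f t. f \<in> set fs \<Longrightarrow> t \<in> A \<Longrightarrow> f t \<noteq> 0"
    and reg: "\<And>t. t \<in> A \<Longrightarrow> qregular q (g t)" "\<And>t. t \<in> A \<Longrightarrow> qregular q (h t)"
      "\<And>f t. f \<in> set fs \<Longrightarrow> t \<in> A \<Longrightarrow> qregular q (g t * q / f t)"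
  shows "(\<lambda>t. vwp q (g t) (map (\<lambda>f. f t) fs) (h t)) holomorphic_on A"
  unfolding vwp_def
proof (rule qh_holomorphic[OF q A])
  let ?N = "\<lambda>t. smult (h t) (vwp_num q (g t) (map (\<lambda>f. f t) fs))"
  let ?D = "\<lambda>t. vwp_den q (g t) (map (\<lambda>b. g t * complex_of_real q / b) (map (\<lambda>f. f t) fs))"
  show "(\<lambda>t. coeff (?N t) j) holomorphic_on A" for j
    unfolding vwp_num_def lins_simps
    by (intro holomorphic_coeff_intros holomorphic_coeff_lins holomorphic_intros hol)
  have D: "?D t = vwp_den q (g t) (map (\<lambda>f. f t) (map (\<lambda>f t. g t * complex_of_real q / f t) fs))" for t
    by (simp add: o_def)
  show "(\<lambda>t. coeff (?D t) j) holomorphic_on A" for j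
  proof -
    have "(\<lambda>t. coeff (lins (map (\<lambda>f. f t) (map (\<lambda>f t. g t * complex_of_real q / f t) fs))) j) holomorphic_on A" for j
    proof (rule holomorphic_coeff_lins)
      fix f' assume "f' \<in> set (map (\<lambda>f t. g t * complex_of_real q / f t) fs)"
      then obtain f where f: "f \<in> set fs" "f' = (\<lambda>t. g t * complex_of_real q / f t)" by auto
      show "f' holomorphic_on A"
        unfolding f(2) by (intro holomorphic_intros hol f(1) nz)
    qed
    note L = this
    show ?thesis unfolding D unfolding vwp_den_def lins_simps
      by (intro L holomorphic_coeff_intros holomorphic_intros hol(1))
  qed
  show "degree (?N t) \<le> length fs + 3" for t
    using degree_vwp_num[of q "g t" "map (\<lambda>f. f t) fs"] by (auto intro: order.trans[OF degree_smult_le])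
  show "degree (?D t) \<le> length fs + 3" for t
    using degree_vwp_den[of q "g t" "map (\<lambda>b. g t * complex_of_real q / b) (map (\<lambda>f. f t) fs)"] by simp
  show "poly (?D t) (of_real q ^ k) \<noteq> 0" if "t \<in> A" for t k
    by (rule poly_vwp_den_nonzero[OF q]) (use reg that in \<open>auto simp: list_all_iff\<close>)
  show "coeff (?N t) 0 * of_real q ^ k \<noteq> 1" if "t \<in> A" for t k
    using reg(2)[OF that] by (auto simp: qregular_def)
qed (use q in \<open>auto simp: poly_vwp_den_inverse\<close>)

lemma open_list_qregular:
  assumes q: "0 < q" "q < 1" and A: "open A" and g: "\<And>g. g \<in> set gs \<Longrightarrow> g holomorphic_on A"
  shows "open {t \<in> A. \<forall>g\<in>set gs. qregular q (g t)}"
  using g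
proof (induction gs)
  case (Cons g gs)
  have "open ({t \<in> A. qregular q (g t)} \<inter> {t \<in> A. \<forall>g\<in>set gs. qregular q (g t)})"
    using Cons by (intro open_Int open_qregular[OF q A]) auto
  also have "\<dots> = {t \<in> A. \<forall>g\<in>set (g # gs). qregular q (g t)}" by auto
  finally show ?case .
qed (use A in simp)

lemma continuous_eq_0_off_countable:
  fixes h :: "complex \<Rightarrow> complex"
  assumes "open U" "continuous_on U h" "countable C" "\<And>t. t \<in> U \<Longrightarrow> t \<notin> C \<Longrightarrow> h t = 0" "t \<in> U"
  shows "h t = 0"
proof (rule ccontr)
  assume "h t \<noteq> 0"
  have "open (U \<inter> h -` (- {0}))"
    using assms(2,1) by (rule continuous_open_preimage) auto
  then obtain r where r: "r > 0" "ball t r \<subseteq> U \<inter> h -` (- {0})"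
    using \<open>h t \<noteq> 0\<close> assms(5) unfolding open_contains_ball by blast
  hence "ball t r \<subseteq> C" using assms(4) by blast
  with assms(3) have "countable (ball t r)" by (rule countable_subset[rotated])
  thus False using uncountable_ball[OF r(1)] by blast
qed

text \<open>Gasper and Rahman, (III.24). The series in the middle of the two applications of (III.23) may be
  degenerate; replacing \<open>b, c\<close> by \<open>b t, c t\<close> makes it regular for all but countably many \<open>t\<close>, and
  both sides are continuous at \<open>t = 1\<close>.\<close>

lemma vwp_two_term:
  assumes q: "0 < q" "q < 1" and a: "a \<noteq> 0" "qregular q a"
    and nz: "b \<noteq> 0" "c \<noteq> 0" "d \<noteq> 0" "e \<noteq> 0" "f \<noteq> 0"
    and x: "x * (b * c * d * e * f) = a ^ 2 * of_real q ^ 2"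
    and m: "m = a * x / e"
    and reg: "qregular q (a * q / b)" "qregular q (a * q / c)" "qregular q (a * q / d)"
      "qregular q (a * q / e)" "qregular q (a * q / f)" "qregular q x"
    and reg': "qregular q m" "qregular q e"
      "qregular q (b * x)" "qregular q (c * x)" "qregular q (d * x)" "qregular q (f * x)"
  shows "qpoch_inf q (a * q / b) * qpoch_inf q (a * q / c) * qpoch_inf q (a * q / d) * qpoch_inf q (a * q / f) *
           qpoch_inf q (m * q) * qpoch_inf q x * vwp q a [b, c, d, e, f] x =
         qpoch_inf q (a * q) * qpoch_inf q e * qpoch_inf q (b * x) * qpoch_inf q (c * x) *
           qpoch_inf q (d * x) * qpoch_inf q (f * x) *
           vwp q m [x, a * q / (b * e), a * q / (c * e), a * q / (d * e), a * q / (e * f)] e"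
proof -
  let ?Q = "complex_of_real q"
  \<comment> \<open>Scaling \<open>b\<close> alone would fix \<open>l = a^2 q/(cde)\<close>, and
    scaling \<open>c\<close> alone would fix \<open>aq/(bf)\<close>. Scaling both makes each of the
    four conditions on the intermediate series depend on \<open>t\<close>; balance then forces
    \<open>x / t^2\<close> and \<open>m / t^2\<close>, while \<open>d, e, f\<close> remain
    fixed.\<close>
  define B C X M where "B t = b * t" and "C t = c * t" and "X t = x / t ^ 2" and "M t = m / t ^ 2"
    for t :: complex
  have Q: "?Q \<noteq> 0" using q by simp
  have x0: "x \<noteq> 0" using x a Q by auto
  define gs where "gs = [\<lambda>t. a * ?Q / B t, \<lambda>t. a * ?Q / C t, X, M, \<lambda>t. B t * X t, \<lambda>t. C t * X t,
     \<lambda>t. d * X t, \<lambda>t. f * X t]"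
  define U where "U = {t \<in> - {0}. \<forall>g\<in>set gs. qregular q (g t)}"
  have U: "open U"
    unfolding U_def by (rule open_list_qregular[OF q])
      (auto simp: gs_def B_def[abs_def] C_def[abs_def] X_def[abs_def] M_def[abs_def] nz intro!: holomorphic_intros)
  have UD: "t \<noteq> 0" "qregular q (a * q / B t)" "qregular q (a * q / C t)" "qregular q (X t)" "qregular q (M t)"
     "qregular q (B t * X t)" "qregular q (C t * X t)" "qregular q (d * X t)" "qregular q (f * X t)" if "t \<in> U" for t
    using that by (auto simp: U_def gs_def)
  define h where "h t = qpoch_inf q (a * q / B t) * qpoch_inf q (a * q / C t) * qpoch_inf q (a * q / d) *
           qpoch_inf q (a * q / f) * qpoch_inf q (M t * q) * qpoch_inf q (X t) *
           vwp q a [B t, C t, d, e, f] (X t) -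
         qpoch_inf q (a * q) * qpoch_inf q e * qpoch_inf q (B t * X t) * qpoch_inf q (C t * X t) *
           qpoch_inf q (d * X t) * qpoch_inf q (f * X t) *
           vwp q (M t) [X t, a * q / (B t * e), a * q / (C t * e), a * q / (d * e), a * q / (e * f)] e" for t
  have t0: "t \<noteq> 0" if "t \<in> U" for t using that by (simp add: U_def)
  note defs = B_def C_def X_def M_def
  have V1: "(\<lambda>t. vwp q a [B t, C t, d, e, f] (X t)) holomorphic_on U"
  proof -
    have "(\<lambda>t. vwp q a (map (\<lambda>f. f t) [B, C, \<lambda>_. d, \<lambda>_. e, \<lambda>_. f]) (X t)) holomorphic_on U"
      by (rule vwp_holomorphic[OF q U])
         (use nz a reg UD t0 in \<open>auto simp: defs[abs_def] intro!: holomorphic_intros\<close>)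
    thus ?thesis by simp
  qed
  \<comment> \<open>The denominator parameters of the second series are \<open>a q/e\<close> and the
    products of the argument with \<open>b, c, d, f\<close>, which is why regularity of these
    products is assumed.\<close>
  have MX: "M t * ?Q / X t = a * ?Q / e" "M t * ?Q / (a * ?Q / (B t * e)) = B t * X t"
    "M t * ?Q / (a * ?Q / (C t * e)) = C t * X t" "M t * ?Q / (a * ?Q / (d * e)) = d * X t"
    "M t * ?Q / (a * ?Q / (e * f)) = f * X t" if "t \<noteq> 0" for t
    using that nz a x0 Q by (simp_all add: defs m divide_simps)
  have V2: "(\<lambda>t. vwp q (M t) [X t, a * q / (B t * e), a * q / (C t * e), a * q / (d * e), a * q / (e * f)] e)
     holomorphic_on U"
  proof -
    have "(\<lambda>t. vwp q (M t) (map (\<lambda>f. f t) [X, \<lambda>t. a * q / (B t * e), \<lambda>t. a * q / (C t * e),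
       \<lambda>_. a * q / (d * e), \<lambda>_. a * q / (e * f)]) e) holomorphic_on U"
    proof (rule vwp_holomorphic[OF q U])
      fix g t assume g: "g \<in> set [X, \<lambda>t. a * q / (B t * e), \<lambda>t. a * q / (C t * e),
       \<lambda>_. a * q / (d * e), \<lambda>_. a * q / (e * f)]" and t: "t \<in> U"
      show "qregular q (M t * q / g t)"
        using g UD[OF t] MX[OF t0[OF t]] reg by auto
      show "g t \<noteq> 0" using g t0[OF t] nz a Q x0 by (auto simp: defs)
    qed (use nz a Q UD t0 reg' in \<open>auto simp: defs[abs_def] intro!: holomorphic_intros\<close>)
    thus ?thesis by simp
  qed
  have "h holomorphic_on U"
    unfolding h_def
    by (intro holomorphic_intros qpoch_inf_holomorphic q V1 V2)
       (use nz t0 in \<open>auto simp: defs[abs_def] intro!: holomorphic_intros\<close>)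
  hence cont: "continuous_on U h" by (rule holomorphic_on_imp_continuous_on)
  define l where "l = a ^ 2 * ?Q / (c * d * e)"
  \<comment> \<open>The four conditions \<open>regl\<close> of
    \<open>vwp_two_term_nondegenerate\<close>, with \<open>l / t\<close> in the role of
    \<open>l\<close>; each fails for countably many \<open>t\<close>.\<close>
  define Bad where "Bad = {t. \<not> qregular q (l / t ^ 1)} \<union> {t. \<not> qregular q (l * q / b / t ^ 2)} \<union>
     {t. \<not> qregular q (l * q / f / t ^ 1)} \<union> {t. \<not> qregular q (a * q / (b * f) / t ^ 1)}"
  have Bad: "countable Bad"
    unfolding Bad_def by (intro countable_Un countable_not_qregular_divide) auto
  have "h 1 = 0"
  proof (rule continuous_eq_0_off_countable[OF U cont Bad])
    fix t assume t: "t \<in> U" "t \<notin> Bad"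
    have e: "l / t * ?Q / B t = l * ?Q / b / t ^ 2" "l / t * ?Q / f = l * ?Q / f / t" "a * ?Q / (B t * f) = a * ?Q / (b * f) / t"
      using t0[OF t(1)] nz by (simp_all add: defs field_simps power2_eq_square)
    have "qpoch_inf q (a * q / B t) * qpoch_inf q (a * q / C t) * qpoch_inf q (a * q / d) *
           qpoch_inf q (a * q / f) * qpoch_inf q (M t * q) * qpoch_inf q (X t) *
           vwp q a [B t, C t, d, e, f] (X t) =
         qpoch_inf q (a * q) * qpoch_inf q e * qpoch_inf q (B t * X t) * qpoch_inf q (C t * X t) *
           qpoch_inf q (d * X t) * qpoch_inf q (f * X t) *
           vwp q (M t) [X t, a * q / (B t * e), a * q / (C t * e), a * q / (d * e), a * q / (e * f)] e"
    proof (rule vwp_two_term_nondegenerate[OF q a, where l = "l / t"])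
      show "X t * (B t * C t * d * e * f) = a ^ 2 * ?Q ^ 2"
        using x t0[OF t(1)] by (simp add: defs field_simps power2_eq_square)
      show "M t = a * X t / e" using nz by (simp add: defs m)
      show "l / t * (C t * d * e) = a ^ 2 * ?Q"
        using nz t0[OF t(1)] by (simp add: defs l_def)
    qed (unfold e, use t t0[OF t(1)] nz reg reg' UD[OF t(1)] in \<open>auto simp: Bad_def B_def C_def\<close>)
    thus "h t = 0" by (simp add: h_def)
  next
    show "1 \<in> U" using reg reg' by (simp add: U_def gs_def defs)
  qed
  thus ?thesis by (simp add: h_def defs)
qed

subsection \<open>The duality relations\<close>

text \<open>The quotient of the four factors with square roots is
  \<open>(1 - al q^(2k)) / (1 - al)\<close>, since conjugate factors multiply to
  \<open>1 - al q^(2i)\<close>. Regularity of \<open>al\<close> allows the division.\<close>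

lemma W87_term_eq:
  assumes al: "qregular q al"
  shows "W87_coeff q al a1 a2 a3 a4 a5 k * x ^ k =
    qh_term q (smult x (vwp_num q al [a1, a2, a3, a4, a5]))
      (vwp_den q al (map (\<lambda>b. al * of_real q / b) [a1, a2, a3, a4, a5])) k"
proof -
  let ?Q = "complex_of_real q"
  have quot: "qpoch q (?Q * s) k * (1 - s) = qpoch q s k * (1 - s * ?Q ^ k)" for s
    using qpoch_add[of q s 1 k] by (simp add: qpoch_Suc[of q s k] qpoch_Suc[of q s 0] mult_ac)
  let ?s = "csqrt al"
  have s2: "?s * ?s = al" using power2_csqrt[of al] by (simp add: power2_eq_square)
  have "(qpoch q (?Q * ?s) k * qpoch q (- (?Q * ?s)) k) * (1 - al) =
      (qpoch q (?Q * ?s) k * (1 - ?s)) * (qpoch q (?Q * (- ?s)) k * (1 - (- ?s)))"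
    using s2 by (simp add: algebra_simps)
  also have "\<dots> = qpoch q ?s k * qpoch q (- ?s) k * (1 - al * ?Q ^ (2 * k))"
  proof -
    have "?Q ^ (2 * k) = ?Q ^ k * ?Q ^ k" by (simp add: mult_2 power_add)
    hence "(1 - ?s * ?Q ^ k) * (1 - (- ?s) * ?Q ^ k) = 1 - (?s * ?s) * ?Q ^ (2 * k)"
      by (simp add: algebra_simps)
    thus ?thesis unfolding quot s2 by (metis mult.assoc mult.left_commute)
  qed
  finally have "(qpoch q (?Q * ?s) k * qpoch q (- (?Q * ?s)) k) * (1 - al) = 
     qpoch q ?s k * qpoch q (- ?s) k * (1 - al * ?Q ^ (2 * k))" .
  moreover have "qpoch q ?s k * qpoch q (- ?s) k \<noteq> 0"
  proof -
    have "1 - ?s * ?Q ^ i \<noteq> 0 \<and> 1 - (- ?s) * ?Q ^ i \<noteq> 0" for i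
    proof -
      have "(1 - ?s * ?Q ^ i) * (1 - (- ?s) * ?Q ^ i) = 1 - al * ?Q ^ (i + i)"
        using s2 by (simp add: algebra_simps power_add)
      thus ?thesis using qregularD[OF al, of "i + i"] by auto
    qed
    thus ?thesis by (auto simp: qpoch_def)
  qed
  moreover have "1 - al \<noteq> 0" using qregularD[OF al, of 0] by simp
  ultimately have r: "(qpoch q (?Q * ?s) k * qpoch q (- (?Q * ?s)) k) / (qpoch q ?s k * qpoch q (- ?s) k) =
      (1 - al * ?Q ^ (2 * k)) / (1 - al)"
    by (simp add: frac_eq_eq mult_ac)
  have split: "W87_coeff q al a1 a2 a3 a4 a5 k =
     ((qpoch q (?Q * ?s) k * qpoch q (- (?Q * ?s)) k) / (qpoch q ?s k * qpoch q (- ?s) k)) *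
     (qpochs q (al # [a1, a2, a3, a4, a5]) k /
      qpochs q (?Q # map (\<lambda>b. al * ?Q / b) [a1, a2, a3, a4, a5]) k)"
    unfolding W87_coeff_def list.map qpochs_simps
    by (simp only: times_divide_eq_left times_divide_eq_right divide_divide_eq_left mult_1_right mult_ac)
  show ?thesis
    unfolding split r
    using qh_term_vwp[OF al, of x "[a1, a2, a3, a4, a5]" 1 "map (\<lambda>b. al * ?Q / b) [a1, a2, a3, a4, a5]" k]
    by (simp only: mult_1_left mult_1_right poly_1 prod.neutral_const times_divide_eq_left times_divide_eq_right mult_ac)
qed

lemma W87_eq_vwp:
  assumes q: "0 < q" "q < 1" and al: "qregular q al"
    and reg: "qregular q (al * q / a1)" "qregular q (al * q / a2)" "qregular q (al * q / a3)"
      "qregular q (al * q / a4)" "qregular q (al * q / a5)" and x: "qregular q x"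
  shows "W87 q al a1 a2 a3 a4 a5 x = vwp q al [a1, a2, a3, a4, a5] x"
proof -
  let ?Q = "complex_of_real q"
  let ?c = "W87_coeff q al a1 a2 a3 a4 a5"
  define g where "g = vwp q al [a1, a2, a3, a4, a5]"
  define D where "D = vwp_den q al (map (\<lambda>b. al * ?Q / b) [a1, a2, a3, a4, a5])"
  define N where "N w = smult w (vwp_num q al [a1, a2, a3, a4, a5])" for w
  note trm = W87_term_eq[OF al, of a1 a2 a3 a4 a5, folded D_def N_def]
  have D: "coeff D 0 = 1" "poly D (1 / ?Q) = 0" "\<And>k. poly D (?Q ^ k) \<noteq> 0"
    using q reg by (auto simp: D_def poly_vwp_den_inverse intro!: poly_vwp_den_nonzero[OF q al])
  have N0: "coeff (N w) 0 = w" for w by (simp add: N_def)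
  have g_eq: "g w = qh q (N w) D" for w by (simp add: g_def vwp_def N_def D_def)
  have g_sum: "g w = (\<Sum>k. ?c k * w ^ k)" if "summable (\<lambda>k. ?c k * w ^ k)" "qregular q w" for w
    unfolding g_eq trm
    by (rule qh_eq_sum[OF q D]) (use that in \<open>auto simp: N0 qregular_def trm\<close>)
  show ?thesis
  proof (cases "summable (\<lambda>k. ?c k * x ^ k)")
    case True
    thus ?thesis using g_sum[OF True x] by (simp add: W87_def g_def)
  next
    case False
    define S where "S = {w. \<forall>i::nat. w * ?Q ^ i \<noteq> 1}"
    have S_eq: "S = {w \<in> UNIV. qregular q w}" by (auto simp: S_def qregular_def)
    have S: "open S" unfolding S_eq by (rule open_qregular[OF q]) (auto intro!: holomorphic_intros)
    have "connected (- {w. \<not> qregular q (1 * w)})"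
      by (intro connected_Compl_countable countable_not_qregular_mult)
    also have "- {w. \<not> qregular q (1 * w)} = S" by (auto simp: S_eq)
    finally have conn: "connected S" .
    have ball: "ball 0 1 \<subseteq> S" using qregular_small[OF q] by (auto simp: S_eq)
    have "g holomorphic_on S"
    proof -
      have "(\<lambda>w. vwp q al (map (\<lambda>f. f w) [\<lambda>_. a1, \<lambda>_. a2, \<lambda>_. a3, \<lambda>_. a4, \<lambda>_. a5]) w) holomorphic_on S"
        unfolding vwp_def
      proof (rule qh_holomorphic[OF q S])
        have *: "map (\<lambda>f. f w) [\<lambda>_. a1, \<lambda>_. a2, \<lambda>_. a3, \<lambda>_. a4, \<lambda>_. a5] = [a1, a2, a3, a4, a5]" for w :: complex
          by simp
        show "(\<lambda>w. coeff (smult w (vwp_num q al (map (\<lambda>f. f w) [\<lambda>_. a1, \<lambda>_. a2, \<lambda>_. a3, \<lambda>_. a4, \<lambda>_. a5]))) j)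
            holomorphic_on S" for j
          unfolding * by (intro holomorphic_coeff_intros holomorphic_intros)
        show "degree (smult w (vwp_num q al (map (\<lambda>f. f w) [\<lambda>_. a1, \<lambda>_. a2, \<lambda>_. a3, \<lambda>_. a4, \<lambda>_. a5]))) \<le> 8" for w
          unfolding * using degree_vwp_num[of q al "[a1, a2, a3, a4, a5]"]
          by (auto intro: order.trans[OF degree_smult_le])
        show "degree (vwp_den q al (map (\<lambda>b. al * ?Q / b) (map (\<lambda>f. f w) [\<lambda>_. a1, \<lambda>_. a2, \<lambda>_. a3, \<lambda>_. a4, \<lambda>_. a5]))) \<le> 8" for w :: complex
          unfolding * using degree_vwp_den[of q al "map (\<lambda>b. al * ?Q / b) [a1, a2, a3, a4, a5]"] by simp
      qed (use D in \<open>auto simp: D_def[simplified, symmetric] S_def\<close>)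
      thus ?thesis by (simp add: g_def[abs_def])
    qed
    moreover have sums: "\<forall>w\<in>ball 0 1. (\<lambda>k. ?c k * w ^ k) sums g w"
    proof
      fix w :: complex assume w: "w \<in> ball 0 1"
      have "summable (\<lambda>k. qh_term q (N w) D k * ?Q ^ (0 * k))"
        by (rule qh_summable[OF q D(1)]) (use w in \<open>simp add: N0\<close>)
      hence s: "summable (\<lambda>k. ?c k * w ^ k)" by (simp add: trm)
      have "qregular q w" using qregular_small[OF q] w by simp
      from g_sum[OF s this] show "(\<lambda>k. ?c k * w ^ k) sums g w" using summable_sums[OF s] by simp
    qed
    moreover have "f x = g x" if f: "f holomorphic_on S" "\<forall>w\<in>ball 0 1. (\<lambda>k. ?c k * w ^ k) sums f w" for f
    proof (rule analytic_continuation_open[OF open_ball S _ conn ball f(1) \<open>g holomorphic_on S\<close>])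
      show "f w = g w" if "w \<in> ball 0 1" for w
        using f(2) sums that sums_unique2 by blast
      show "x \<in> S" using x by (simp add: S_eq)
    qed auto
    ultimately have "(THE y. \<exists>f. f holomorphic_on S \<and> (\<forall>w\<in>ball 0 1. (\<lambda>k. ?c k * w ^ k) sums f w) \<and> y = f x) = g x"
      by (intro the_equality) blast+
    thus ?thesis using False by (simp add: W87_def S_def g_def)
  qed
qed

section \<open>The normalized functions as products with the continued series\<close>

lemma qpochs_nonzero_iff: "qpochs_nonzero q xs \<longleftrightarrow> list_all (qregular q) xs"
  by (auto simp: qpochs_nonzero_def qregular_def list_all_iff)

text \<open>Regularity of both square roots excludes \<open>al q^i = 1\<close> only for even
  \<open>i\<close>. The odd exponents come from \<open>al q\<close>, which is an argument of a
  denominator product: \<open>bcdz q^(2 gamma+1)\<close> in S and \<open>bcd/z\<close> in R.\<close>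

lemma qregular_csqrt:
  assumes "qregular q (csqrt al)" "qregular q (al * of_real q)"
  shows "qregular q al"
  unfolding qregular_def
proof
  fix i :: nat
  show "al * of_real q ^ i \<noteq> 1"
  proof (cases i)
    case 0
    thus ?thesis using assms(1) by (auto simp: qregular_def dest: spec[of _ 0])
  next
    case (Suc j)
    thus ?thesis using assms(2) by (auto simp: qregular_def mult_ac)
  qed
qed

lemma qpochs_inf_simps [simp]:
  "qpochs_inf q [] = 1" "qpochs_inf q (x # xs) = qpoch_inf q x * qpochs_inf q xs"
  by (simp_all add: qpochs_inf_def)

lemma of_real_powr_eq:
  assumes "0 < q"
  shows "complex_of_real q powr w = exp (w * of_real (ln q))"
  using assms by (simp add: powr_def Ln_of_real)

lemma of_real_powr_shifts:
  assumes "0 < q"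
  shows "complex_of_real q powr (g + 1) = (of_real q powr g) * of_real q"
    "complex_of_real q powr (g - 1) = (of_real q powr g) / of_real q"
    "complex_of_real q powr (- g) = 1 / (of_real q powr g)"
    "complex_of_real q powr (2 * g) = (of_real q powr g) ^ 2"
    "complex_of_real q powr (2 * g + 1) = (of_real q powr g) ^ 2 * of_real q"
  unfolding of_real_powr_eq[OF assms]
  by (simp_all add: ring_distribs left_diff_distrib exp_add exp_diff exp_minus exp_of_real_ln[OF assms]
        mult.assoc exp_double divide_inverse)

lemma W87_defined_imp:
  assumes q: "0 < q" "q < 1" and W: "W87_defined q al a1 a2 a3 a4 a5 x" and alq: "qregular q (al * of_real q)"
  shows "qregular q al" "qregular q (al * of_real q / a1)" "qregular q (al * of_real q / a2)"
    "qregular q (al * of_real q / a3)" "qregular q (al * of_real q / a4)" "qregular q (al * of_real q / a5)"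
    "qregular q x" "W87 q al a1 a2 a3 a4 a5 x = vwp q al [a1, a2, a3, a4, a5] x"
proof -
  show "qregular q al"
    using W alq qregular_csqrt[of q al] unfolding W87_defined_def qpochs_nonzero_iff list.pred_inject by blast
  moreover show "qregular q (al * of_real q / a1)" "qregular q (al * of_real q / a2)"
    "qregular q (al * of_real q / a3)" "qregular q (al * of_real q / a4)" "qregular q (al * of_real q / a5)"
    "qregular q x"
    using W unfolding W87_defined_def qpochs_nonzero_iff list.pred_inject mult.commute[of al "of_real q"] by blast+
  ultimately show "W87 q al a1 a2 a3 a4 a5 x = vwp q al [a1, a2, a3, a4, a5] x"
    by (intro W87_eq_vwp[OF q])
qed

text \<open>The exponentials are abstracted to \<open>a, ..., z, G\<close> so that the same formula
  can be instantiated with the original quantities and with their duals. \<open>R_generic_eq\<close>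
  has the same form.\<close>

lemma S_generic_eq:
  fixes \<alpha> a b c d z G :: complex and q :: real
  defines "\<alpha> \<equiv> b * c * d * z * G ^ 2"
  assumes q: "0 < q" "q < 1" and S: "S_generic q g la lb lc ld lz"
    and e: "exp la = a" "exp lb = b" "exp lc = c" "exp ld = d" "exp lz = z" "of_real q powr g = G"
  shows "S_bar q g la lb lc ld lz = b * c * d * z * exp (g * (la + lz)) *
      (qpoch_inf q (a * b * c * d * G ^ 2) * qpoch_inf q (b * z * (G * q)) * qpoch_inf q (c * z * (G * q)) *
       qpoch_inf q (d * z * (G * q)) * qpoch_inf q (b * c * d * z * G)) /
      (qpoch_inf q (b * z) * qpoch_inf q (c * z) * qpoch_inf q (d * z) *
       qpoch_inf q (b * c * G) * qpoch_inf q (b * d * G) * qpoch_inf q (c * d * G) * qpoch_inf q (G * q) *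
       qpoch_inf q (\<alpha> * q)) *
      vwp q \<alpha> [b * c * G, b * d * G, c * d * G, G * q, z * q / a] (a * z)"
    and "list_all (qregular q) [\<alpha>, \<alpha> * q, \<alpha> * q / (b * c * G), \<alpha> * q / (b * d * G), \<alpha> * q / (c * d * G),
      \<alpha> * q / (G * q), \<alpha> * q / (z * q / a), a * z, G * q]"
proof -
  note S' = S[unfolded S_generic_def Let_def e of_real_powr_shifts[OF q(1)] qpochs_nonzero_iff]
  have \<alpha>q: "qregular q (\<alpha> * q)" using S' by (simp add: \<alpha>_def mult.assoc)
  have W: "W87_defined q \<alpha> (b * c * G) (b * d * G) (c * d * G) (G * q) (z * q / a) (a * z)"
    using S' by (simp add: \<alpha>_def)
  note W' = W87_defined_imp[OF q W \<alpha>q]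
  show "list_all (qregular q) [\<alpha>, \<alpha> * q, \<alpha> * q / (b * c * G), \<alpha> * q / (b * d * G), \<alpha> * q / (c * d * G),
      \<alpha> * q / (G * q), \<alpha> * q / (z * q / a), a * z, G * q]"
    using W' \<alpha>q S' by simp
  have \<alpha>q': "b * c * d * z * (G ^ 2 * of_real q) = \<alpha> * q" by (simp add: \<alpha>_def)
  show "S_bar q g la lb lc ld lz = b * c * d * z * exp (g * (la + lz)) *
      (qpoch_inf q (a * b * c * d * G ^ 2) * qpoch_inf q (b * z * (G * q)) * qpoch_inf q (c * z * (G * q)) *
       qpoch_inf q (d * z * (G * q)) * qpoch_inf q (b * c * d * z * G)) /
      (qpoch_inf q (b * z) * qpoch_inf q (c * z) * qpoch_inf q (d * z) *
       qpoch_inf q (b * c * G) * qpoch_inf q (b * d * G) * qpoch_inf q (c * d * G) * qpoch_inf q (G * q) *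
       qpoch_inf q (\<alpha> * q)) *
      vwp q \<alpha> [b * c * G, b * d * G, c * d * G, G * q, z * q / a] (a * z)"
    unfolding S_bar_def s_bar_def s_fun_def Let_def e of_real_powr_shifts[OF q(1)] \<alpha>q'
      \<alpha>_def[symmetric] W'(8) qpochs_inf_simps mult_1_right
    by (simp only: times_divide_eq_left times_divide_eq_right divide_divide_eq_left mult_ac)
qed

lemma R_generic_eq:
  fixes \<alpha> a b c d z G :: complex and q :: real
  defines "\<alpha> \<equiv> b * c * d / (q * z)"
  assumes q: "0 < q" "q < 1" and R: "R_generic q g la lb lc ld lz"
    and e: "exp la = a" "exp lb = b" "exp lc = c" "exp ld = d" "exp lz = z" "of_real q powr g = G"
  shows "R_bar q g la lb lc ld lz =
      b * c * d * exp (lz * (2 - (la + lb + lc + ld) / of_real (ln q))) * exp (g * (la - lz)) *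
      (qpoch_inf q (b * c) * qpoch_inf q (b * d) * qpoch_inf q (c * d) * qpoch_inf q (q * z / a) *
       qpoch_inf q (q * z / b) * qpoch_inf q (q * z / c) * qpoch_inf q (q * z / d) *
       qpoch_inf q (a * b * G) * qpoch_inf q (a * c * G) * qpoch_inf q (a * d * G) * qpoch_inf q (b * c * d * G / z)) /
      (qpoch_inf q (b * z) * qpoch_inf q (c * z) * qpoch_inf q (d * z) * qpoch_inf q (b * c * d / z) *
       qpoch_inf q (b * c * G) * qpoch_inf q (b * d * G) * qpoch_inf q (c * d * G) * qpoch_inf q (a * z * G)) *
      vwp q \<alpha> [b / z, c / z, d / z, a * b * c * d * (G / q), 1 / G] (q * z / a)"
    and "list_all (qregular q) [\<alpha>, b * c * d / z, \<alpha> * q / (b / z), \<alpha> * q / (c / z), \<alpha> * q / (d / z),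
      \<alpha> * q / (a * b * c * d * (G / q)), \<alpha> * q / (1 / G), q * z / a]"
proof -
  note R' = R[unfolded R_generic_def Let_def e of_real_powr_shifts[OF q(1)] qpochs_nonzero_iff]
  have \<alpha>q': "\<alpha> * q = b * c * d / z" using q by (simp add: \<alpha>_def)
  have \<alpha>q: "qregular q (\<alpha> * q)" using R' by (simp add: \<alpha>q')
  have W: "W87_defined q \<alpha> (b / z) (c / z) (d / z) (a * b * c * d * (G / q)) (1 / G) (q * z / a)"
    using R' by (simp add: \<alpha>_def)
  note W' = W87_defined_imp[OF q W \<alpha>q]
  show "list_all (qregular q) [\<alpha>, b * c * d / z, \<alpha> * q / (b / z), \<alpha> * q / (c / z), \<alpha> * q / (d / z),
      \<alpha> * q / (a * b * c * d * (G / q)), \<alpha> * q / (1 / G), q * z / a]"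
    using W' \<alpha>q R' unfolding list.pred_inject by blast
  show "R_bar q g la lb lc ld lz =
      b * c * d * exp (lz * (2 - (la + lb + lc + ld) / of_real (ln q))) * exp (g * (la - lz)) *
      (qpoch_inf q (b * c) * qpoch_inf q (b * d) * qpoch_inf q (c * d) * qpoch_inf q (q * z / a) *
       qpoch_inf q (q * z / b) * qpoch_inf q (q * z / c) * qpoch_inf q (q * z / d) *
       qpoch_inf q (a * b * G) * qpoch_inf q (a * c * G) * qpoch_inf q (a * d * G) * qpoch_inf q (b * c * d * G / z)) /
      (qpoch_inf q (b * z) * qpoch_inf q (c * z) * qpoch_inf q (d * z) * qpoch_inf q (b * c * d / z) *
       qpoch_inf q (b * c * G) * qpoch_inf q (b * d * G) * qpoch_inf q (c * d * G) * qpoch_inf q (a * z * G)) *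
      vwp q \<alpha> [b / z, c / z, d / z, a * b * c * d * (G / q), 1 / G] (q * z / a)"
    unfolding R_bar_def r_bar_def r_fun_def Let_def e of_real_powr_shifts[OF q(1)]
      \<alpha>_def[symmetric] W'(8) qpochs_inf_simps mult_1_right
    by (simp only: times_divide_eq_left times_divide_eq_right divide_divide_eq_left mult_ac)
qed

text \<open>\<open>K\<close> holds the powers and \<open>t\<close>, \<open>D\<close> the infinite
  products shared by the two sides. Only \<open>n\<close>, \<open>n'\<close>, \<open>p\<close>,
  \<open>r\<close> and the series take part in the two-term transformation.\<close>

lemma cross_multiplied_eq:
  fixes W W' :: complex
  assumes "p \<noteq> 0" "r \<noteq> 0" "n * r * W = p * n' * W'"
  shows "K * (n * t) / (D * p) * W = K * (n' * t) / (D * r) * W'"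
proof -
  have "n * W / p = n' * W' / r" using assms by (simp add: frac_eq_eq mult_ac)
  hence "(K * t / D) * (n * W / p) = (K * t / D) * (n' * W' / r)" by simp
  thus ?thesis by (simp add: mult_ac)
qed

theorem lemma2p2:
  fixes q :: real
    and g la lb lc ld lz :: complex
    and g' la' lb' lc' ld' lz' :: complex
  assumes "0 < q" and "q < 1"
    and "la' = dual_log_a q la lb lc ld"
    and "lb' = dual_log q la' la lb"
    and "lc' = dual_log q la' la lc"
    and "ld' = dual_log q la' la ld"
    and "lz' = dual_log_z q la' g"
    and "g' = dual_gamma q la lz"
  shows
    "(R_generic q g la lb lc ld lz \<and> R_generic q g' la' lb' lc' ld' lz' \<longrightarrow>
        R_bar q g la lb lc ld lz = R_bar q g' la' lb' lc' ld' lz') \<and>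
     (S_generic q g la lb lc ld lz \<and> S_generic q g' la' lb' lc' ld' lz' \<longrightarrow>
        S_bar q g la lb lc ld lz = S_bar q g' la' lb' lc' ld' lz')"
proof -
  note q = assms(1,2)
  define Q where "Q = complex_of_real q"
  define L where "L = complex_of_real (ln q)"
  have Q: "Q \<noteq> 0" using q by (simp add: Q_def)
  have L: "L \<noteq> 0" using q by (simp add: L_def)
  define a b c d z G where "a = exp la" and "b = exp lb" and "c = exp lc" and "d = exp ld" and "z = exp lz"
    and "G = Q powr g"
  define A where "A = exp la'"
  have nz: "a \<noteq> 0" "b \<noteq> 0" "c \<noteq> 0" "d \<noteq> 0" "z \<noteq> 0" "G \<noteq> 0" "A \<noteq> 0"
    using Q by (simp_all add: a_def b_def c_def d_def z_def G_def A_def)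
  \<comment> \<open>\<open>G\<close> and \<open>H\<close> are \<open>q^gamma\<close> and its dual.
    By \<open>HQ\<close> and \<open>AZ\<close> below, duality exchanges \<open>a z\<close> and
    \<open>q^(gamma+1)\<close>.\<close>
  define B C D Z H where "B = Q ^ 2 / (A * a * b)" and "C = Q ^ 2 / (A * a * c)" and "D = Q ^ 2 / (A * a * d)"
    and "Z = G * Q / A" and "H = a * z / Q"
  have e: "exp la = a" "exp lb = b" "exp lc = c" "exp ld = d" "exp lz = z" "of_real q powr g = G"
    by (simp_all add: a_def b_def c_def d_def z_def G_def Q_def)
  have g'L: "g' * L = la + lz - L"
    using L by (simp add: assms(8) dual_gamma_def L_def[symmetric] field_simps)
  have H: "of_real q powr g' = H"
    unfolding of_real_powr_eq[OF q(1)] L_def[symmetric] g'L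
    using q by (simp add: exp_add exp_diff e H_def L_def Q_def exp_of_real_ln)
  have e': "exp la' = A" "exp lb' = B" "exp lc' = C" "exp ld' = D" "exp lz' = Z" "of_real q powr g' = H"
    unfolding assms(4-7)
    by (simp_all add: exp_dual_log[OF q(1)] exp_dual_log_z[OF q(1)] of_real_powr_shifts(1)[OF q(1), folded Q_def]
         H[unfolded assms(8), folded Q_def] e
         A_def[symmetric] B_def C_def D_def Z_def Q_def[symmetric] G_def[symmetric] assms(8))
  have AA: "A * A * (a * b * c * d) = Q ^ 3"
    using exp_dual_log_a[OF q(1), of la lb lc ld] nz
    by (simp add: assms(3)[symmetric] e e' Q_def[symmetric] power2_eq_square field_simps)
  have BCD: "B = Q ^ 2 / (A * a * b)" "C = Q ^ 2 / (A * a * c)" "D = Q ^ 2 / (A * a * d)" "Z = G * Q / A" "H = a * z / Q"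
    by (simp_all add: B_def C_def D_def Z_def H_def)
  \<comment> \<open>The dictionary for matching the infinite products. The identities
    \<open>BZ\<close> and \<open>BH\<close> show that duality exchanges \<open>b z\<close> with
    \<open>c d q^gamma\<close> and similarly for the other two pairs. The products proved here
    contain \<open>A\<close> only through its square, given by \<open>AA\<close>.\<close>
  have BC: "B * C = Q * d / a" "B * D = Q * c / a" "C * D = Q * b / a"
    using nz Q AA by (simp_all add: BCD divide_simps) algebra+
  have BZ: "B * Z = c * d * G" "C * Z = b * d * G" "D * Z = b * c * G"
    using nz Q AA by (simp_all add: BCD divide_simps) algebra+
  have BH: "B * C * H = d * z" "B * D * H = c * z" "C * D * H = b * z"
    using nz Q unfolding BC by (simp_all add: BCD(5))
  have HQ: "H * Q = a * z" using Q by (simp add: BCD)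
  have AZ: "A * Z = G * Q" using nz by (simp add: BCD)
  have ZA: "Z * Q / A = a * b * c * d * G / Q"
    using nz Q AA by (simp add: BCD divide_simps) algebra
  show ?thesis
  proof (intro conjI impI; elim conjE)
    assume S: "S_generic q g la lb lc ld lz" "S_generic q g' la' lb' lc' ld' lz'"
    have pw: "B * C * D * Z * exp (g' * (la' + lz')) = b * c * d * z * exp (g * (la + lz))"
    proof -
      \<comment> \<open>In units of \<open>log q\<close> the dual logarithms are polynomials, and
        equality of the two exponents becomes a polynomial identity.\<close>
      define xa xb xc xd xz where "xa = la / L" and "xb = lb / L" and "xc = lc / L" and "xd = ld / L" and "xz = lz / L"
      have l: "la = xa * L" "lb = xb * L" "lc = xc * L" "ld = xd * L" "lz = xz * L"
        using L by (simp_all add: xa_def xb_def xc_def xd_def xz_def)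
      have "B * C * D * Z * exp (g' * (la' + lz')) = exp (lb' + lc' + ld' + lz' + g' * (la' + lz'))"
        by (simp add: exp_add e')
      also have "lb' + lc' + ld' + lz' + g' * (la' + lz') = lb + lc + ld + lz + g * (la + lz)"
        using L unfolding assms(3-8) dual_log_a_def dual_log_def dual_log_z_def dual_gamma_def L_def[symmetric] l
        by (simp add: field_simps)
      also have "exp \<dots> = b * c * d * z * exp (g * (la + lz))"
        by (simp add: exp_add e)
      finally show ?thesis .
    qed
    show "S_bar q g la lb lc ld lz = S_bar q g' la' lb' lc' ld' lz'"
    proof -
      define \<alpha> where "\<alpha> = b * c * d * z * G ^ 2"
      define \<mu> where "\<mu> = B * C * D * Z * H ^ 2"
      \<comment> \<open>\<open>e\<close> and \<open>x\<close> are the parameter and the argument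
        that trade places: the dual series has argument \<open>A * Z = e\<close> and the parameter
        \<open>H * Q = x\<close>.\<close>
      define e where "e = G * Q"
      define x where "x = a * z"
      note E1 = S_generic_eq[OF q S(1) e, folded Q_def, folded \<alpha>_def]
      note E2 = S_generic_eq[OF q S(2) e', folded Q_def, folded \<mu>_def, unfolded BZ BH HQ ZA AZ]
      \<comment> \<open>The base of the dual series is the base \<open>a x/e\<close> of the second
        series in \<open>vwp_two_term\<close>.\<close>
      have "\<mu> = (B * C * H) * (D * Z) * H" by (simp add: \<mu>_def power2_eq_square)
      hence \<mu>: "\<mu> = \<alpha> * x / e"
        unfolding BH BZ using nz Q by (simp add: BCD(5) \<alpha>_def e_def x_def power2_eq_square)
      have \<alpha>Q: "\<alpha> * Q / (b * c * G) = d * z * e" "\<alpha> * Q / (b * d * G) = c * z * e"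
        "\<alpha> * Q / (c * d * G) = b * z * e" "\<alpha> * Q / (z * Q / a) = a * b * c * d * G ^ 2"
        "\<alpha> * Q / (b * c * G * e) = d * z" "\<alpha> * Q / (b * d * G * e) = c * z"
        "\<alpha> * Q / (c * d * G * e) = b * z" "\<alpha> * Q / (e * (z * Q / a)) = a * b * c * d * G / Q"
        using nz Q by (simp_all add: \<alpha>_def e_def divide_simps power2_eq_square)
      have "A * B * C * D * H ^ 2 = (B * C * H) * (A * D) * H" by (simp add: power2_eq_square)
      also have "A * D = Q ^ 2 / (a * d)" using nz by (simp add: BCD)
      finally have num1: "A * B * C * D * H ^ 2 = (z * Q / a) * x"
        unfolding BH using nz Q by (simp add: BCD(5) x_def power2_eq_square)
      have "B * C * D * Z * H = (B * C * H) * (D * Z)" by simp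
      hence num2: "B * C * D * Z * H = b * c * d * z * G"
        unfolding BH BZ by simp
      have \<mu>Q: "\<mu> * Q / (d * z) = b * c * G * x" "\<mu> * Q / (c * z) = b * d * G * x"
        "\<mu> * Q / (b * z) = c * d * G * x" "\<mu> * Q / (a * b * c * d * G / Q) = (z * Q / a) * x"
        using nz Q by (simp_all add: \<mu> \<alpha>_def e_def x_def divide_simps power2_eq_square)
      have reg: "qregular q \<alpha>" "qregular q (\<alpha> * Q)" "qregular q (d * z * e)" "qregular q (c * z * e)"
        "qregular q (b * z * e)" "qregular q (\<alpha> * Q / e)" "qregular q (a * b * c * d * G ^ 2)"
        "qregular q x" "qregular q e"
        using E1(2)[folded x_def e_def, unfolded \<alpha>Q] unfolding list.pred_inject by blast+
      have reg': "qregular q \<mu>" "qregular q (\<mu> * Q)" "qregular q (b * c * G * x)" "qregular q (b * d * G * x)"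
        "qregular q (c * d * G * x)" "qregular q ((z * Q / a) * x)"
        using E2(2)[folded x_def e_def, unfolded \<mu>Q] unfolding list.pred_inject by blast+
      have T: "qpoch_inf q (\<alpha> * q / (b * c * G)) * qpoch_inf q (\<alpha> * q / (b * d * G)) *
           qpoch_inf q (\<alpha> * q / (c * d * G)) * qpoch_inf q (\<alpha> * q / (z * Q / a)) *
           qpoch_inf q (\<mu> * q) * qpoch_inf q x * vwp q \<alpha> [b * c * G, b * d * G, c * d * G, e, z * Q / a] x =
         qpoch_inf q (\<alpha> * q) * qpoch_inf q e * qpoch_inf q (b * c * G * x) * qpoch_inf q (b * d * G * x) *
           qpoch_inf q (c * d * G * x) * qpoch_inf q ((z * Q / a) * x) *
           vwp q \<mu> [x, \<alpha> * q / (b * c * G * e), \<alpha> * q / (b * d * G * e), \<alpha> * q / (c * d * G * e),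
             \<alpha> * q / (e * (z * Q / a))] e"
      proof (rule vwp_two_term[OF q])
        show "x * (b * c * G * (b * d * G) * (c * d * G) * e * (z * Q / a)) = \<alpha> ^ 2 * complex_of_real q ^ 2"
          unfolding Q_def[symmetric]
          using nz by (simp add: x_def e_def \<alpha>_def power2_eq_square)
      qed (unfold Q_def[symmetric] \<alpha>Q, use reg reg' nz Q \<mu> in \<open>simp_all add: \<alpha>_def e_def x_def\<close>)
      have P: "vwp q \<mu> [x, d * z, c * z, b * z, a * b * c * d * G / Q] e =
         vwp q \<mu> [d * z, c * z, b * z, x, a * b * c * d * G / Q] e"
        by (rule vwp_permute) simp
      note T' = T[folded Q_def, unfolded \<alpha>Q P]
      have nonzero: "qpoch_inf q e * qpoch_inf q (\<alpha> * Q) \<noteq> 0" "qpoch_inf q x * qpoch_inf q (\<mu> * Q) \<noteq> 0"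
        using reg(2,8,9) reg'(2) by (simp_all add: qpoch_inf_eq_0_iff[OF q])
      define num num' where "num = qpoch_inf q (d * z * e) * qpoch_inf q (c * z * e) * qpoch_inf q (b * z * e) *
          qpoch_inf q (a * b * c * d * G ^ 2)"
        and "num' = qpoch_inf q (b * c * G * x) * qpoch_inf q (b * d * G * x) *
           qpoch_inf q (c * d * G * x) * qpoch_inf q ((z * Q / a) * x)"
      have "num * (qpoch_inf q x * qpoch_inf q (\<mu> * Q)) * vwp q \<alpha> [b * c * G, b * d * G, c * d * G, e, z * Q / a] x =
        (qpoch_inf q e * qpoch_inf q (\<alpha> * Q)) * num' * vwp q \<mu> [d * z, c * z, b * z, x, a * b * c * d * G / Q] e"
        using T' unfolding num_def num'_def by (simp only: mult_ac)
      \<comment> \<open>The product in \<open>t\<close> is its own dual, and the two groups of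
        products in \<open>D\<close> are exchanged by duality.\<close>
      note cross = cross_multiplied_eq[OF nonzero this, where K = "b * c * d * z * exp (g * (la + lz))" and
         t = "qpoch_inf q (b * c * d * z * G)" and D = "qpoch_inf q (b * z) * qpoch_inf q (c * z) * qpoch_inf q (d * z) *
           (qpoch_inf q (b * c * G) * qpoch_inf q (b * d * G) * qpoch_inf q (c * d * G))"]
      show ?thesis
        unfolding E1(1) E2(1) num2 pw using cross unfolding num_def num'_def num1 e_def x_def by (simp only: mult_ac)
    qed
  next
    assume R: "R_generic q g la lb lc ld lz" "R_generic q g' la' lb' lc' ld' lz'"
    \<comment> \<open>Dualizing \<open>(a/z)^gamma\<close> produces a term with
      \<open>log z * log(abcd)\<close> in the exponent; on the original side this term comes from
      the power of \<open>z\<close> in the normalization.\<close>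
    have pw: "B * C * D * exp (lz' * (2 - (la' + lb' + lc' + ld') / L)) * exp (g' * (la' - lz')) =
      b * c * d * exp (lz * (2 - (la + lb + lc + ld) / L)) * exp (g * (la - lz))"
    proof -
      define xa xb xc xd xz where "xa = la / L" and "xb = lb / L" and "xc = lc / L" and "xd = ld / L" and "xz = lz / L"
      have l: "la = xa * L" "lb = xb * L" "lc = xc * L" "ld = xd * L" "lz = xz * L"
        using L by (simp_all add: xa_def xb_def xc_def xd_def xz_def)
      have "B * C * D * exp (lz' * (2 - (la' + lb' + lc' + ld') / L)) * exp (g' * (la' - lz')) =
         exp (lb' + lc' + ld' + lz' * (2 - (la' + lb' + lc' + ld') / L) + g' * (la' - lz'))"
        by (simp add: exp_add e')
      also have "lb' + lc' + ld' + lz' * (2 - (la' + lb' + lc' + ld') / L) + g' * (la' - lz') =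
        lb + lc + ld + lz * (2 - (la + lb + lc + ld) / L) + g * (la - lz)"
        using L unfolding assms(3-8) dual_log_a_def dual_log_def dual_log_z_def dual_gamma_def L_def[symmetric] l
        by (simp add: field_simps)
      also have "exp \<dots> = b * c * d * exp (lz * (2 - (la + lb + lc + ld) / L)) * exp (g * (la - lz))"
        by (simp add: exp_add e)
      finally show ?thesis .
    qed
    show "R_bar q g la lb lc ld lz = R_bar q g' la' lb' lc' ld' lz'"
    proof -
      define \<alpha> where "\<alpha> = b * c * d / (Q * z)"
      define \<mu> where "\<mu> = B * C * D / (Q * Z)"
      \<comment> \<open>Here the trading pair consists of the fourth parameter and the argument: the
        dual argument is \<open>Q * Z / A = e\<close>, and by \<open>ABCD\<close> the dual fourth
        parameter is \<open>x\<close>.\<close>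
      define e where "e = a * b * c * d * (G / Q)"
      define x where "x = Q * z / a"
      have QZ: "Q * Z / A = e" "Q * Z / B = a * b * G" "Q * Z / C = a * c * G" "Q * Z / D = a * d * G"
        using ZA nz Q by (simp_all add: e_def BCD mult_ac power2_eq_square)
      have AB: "A * B * H = Q * z / b" "A * C * H = Q * z / c" "A * D * H = Q * z / d"
        using nz Q by (simp_all add: BCD power2_eq_square)
      have AZH: "A * Z * H = a * z * G" unfolding AZ using Q by (simp add: BCD(5))
      have BZ': "B / Z = Q / (a * b * G)" "C / Z = Q / (a * c * G)" "D / Z = Q / (a * d * G)"
        unfolding QZ(2-4)[symmetric] using nz Q by (simp_all add: BCD)
      have "B * C * D / Z = (B * C) * (D / Z)" by simp
      also have "\<dots> = Q ^ 2 / (a ^ 2 * G)"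
        unfolding BC BZ' using nz by (simp add: power2_eq_square)
      finally have BCDZ: "B * C * D / Z = Q ^ 2 / (a ^ 2 * G)" .
      have "B * C * D * H / Z = (B * C * D / Z) * H" by simp
      hence BCDHZ: "B * C * D * H / Z = 1 / G * x"
        unfolding BCDZ using nz Q by (simp add: BCD(5) x_def power2_eq_square)
      have "A * B * C * D * (H / Q) = (A * B * H) * (C * D) / Q" by simp
      hence ABCD: "A * B * C * D * (H / Q) = x"
        unfolding AB BC using nz Q by (simp add: x_def)
      have \<mu>_eq: "\<mu> = B * C * D / Z / Q" by (simp add: \<mu>_def)
      have \<mu>: "\<mu> = \<alpha> * x / e"
        unfolding \<mu>_eq BCDZ using nz Q by (simp add: \<alpha>_def e_def x_def power2_eq_square)
      note E1 = R_generic_eq[OF q R(1) e, folded Q_def L_def, folded \<alpha>_def]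
      note E2 = R_generic_eq[OF q R(2) e', folded Q_def L_def, folded \<mu>_def]
      have \<alpha>Q: "\<alpha> * Q / (b / z) = c * d" "\<alpha> * Q / (c / z) = b * d"
        "\<alpha> * Q / (d / z) = b * c" "\<alpha> * Q / (1 / G) = b * c * d * G / z"
        "\<alpha> * Q / (b / z * e) = Q / (a * b * G)" "\<alpha> * Q / (c / z * e) = Q / (a * c * G)"
        "\<alpha> * Q / (d / z * e) = Q / (a * d * G)" "\<alpha> * Q / (e * (1 / G)) = 1 / H" "\<alpha> * Q = b * c * d / z"
        using nz Q by (simp_all add: \<alpha>_def e_def BCD(5))
      have \<mu>Q: "\<mu> * Q / (Q / (a * b * G)) = b / z * x" "\<mu> * Q / (Q / (a * c * G)) = c / z * x"
        "\<mu> * Q / (Q / (a * d * G)) = d / z * x" "\<mu> * Q / (1 / H) = 1 / G * x" "\<mu> * Q = B * C * D / Z"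
        using nz Q by (simp_all add: \<mu> \<alpha>_def e_def x_def BCD(5) BCDZ power2_eq_square)
      have reg: "qregular q \<alpha>" "qregular q (b * c * d / z)" "qregular q (c * d)" "qregular q (b * d)"
        "qregular q (b * c)" "qregular q (\<alpha> * Q / e)" "qregular q (b * c * d * G / z)" "qregular q x"
        using E1(2)[folded x_def e_def, unfolded \<alpha>Q(1-4)] unfolding list.pred_inject by blast+
      have reg': "qregular q \<mu>" "qregular q (B * C * D / Z)" "qregular q (b / z * x)" "qregular q (c / z * x)"
        "qregular q (d / z * x)" "qregular q (1 / G * x)" "qregular q e"
        using E2(2)[unfolded BZ' \<mu>Q(1-4) QZ] unfolding list.pred_inject by blast+
      have T: "qpoch_inf q (\<alpha> * q / (b / z)) * qpoch_inf q (\<alpha> * q / (c / z)) *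
           qpoch_inf q (\<alpha> * q / (d / z)) * qpoch_inf q (\<alpha> * q / (1 / G)) *
           qpoch_inf q (\<mu> * q) * qpoch_inf q x * vwp q \<alpha> [b / z, c / z, d / z, e, 1 / G] x =
         qpoch_inf q (\<alpha> * q) * qpoch_inf q e * qpoch_inf q (b / z * x) * qpoch_inf q (c / z * x) *
           qpoch_inf q (d / z * x) * qpoch_inf q (1 / G * x) *
           vwp q \<mu> [x, \<alpha> * q / (b / z * e), \<alpha> * q / (c / z * e), \<alpha> * q / (d / z * e),
             \<alpha> * q / (e * (1 / G))] e"
      proof (rule vwp_two_term[OF q])
        show "x * (b / z * (c / z) * (d / z) * e * (1 / G)) = \<alpha> ^ 2 * complex_of_real q ^ 2"
          unfolding Q_def[symmetric]
          using nz Q by (simp add: x_def e_def \<alpha>_def power2_eq_square)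
      qed (unfold Q_def[symmetric] \<alpha>Q(1-4), use reg reg' nz Q \<mu> in \<open>simp_all add: \<alpha>_def e_def x_def\<close>)
      have P: "vwp q \<mu> [x, Q / (a * b * G), Q / (a * c * G), Q / (a * d * G), 1 / H] e =
         vwp q \<mu> [Q / (a * b * G), Q / (a * c * G), Q / (a * d * G), x, 1 / H] e"
        by (rule vwp_permute) simp
      note T' = T[folded Q_def, unfolded \<alpha>Q(1-8) P, unfolded \<alpha>Q(9) \<mu>Q(5)]
      have nonzero: "qpoch_inf q (b * c * d / z) \<noteq> 0" "qpoch_inf q (B * C * D / Z) \<noteq> 0"
        using reg(2) reg'(2) by (simp_all add: qpoch_inf_eq_0_iff[OF q])
      define num num' where "num = qpoch_inf q (c * d) * qpoch_inf q (b * d) * qpoch_inf q (b * c) *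
          qpoch_inf q (b * c * d * G / z) * qpoch_inf q x"
        and "num' = qpoch_inf q e * qpoch_inf q (b / z * x) * qpoch_inf q (c / z * x) *
           qpoch_inf q (d / z * x) * qpoch_inf q (1 / G * x)"
      have "num * qpoch_inf q (B * C * D / Z) * vwp q \<alpha> [b / z, c / z, d / z, e, 1 / G] x =
        qpoch_inf q (b * c * d / z) * num' * vwp q \<mu> [Q / (a * b * G), Q / (a * c * G), Q / (a * d * G), x, 1 / H] e"
        using T' unfolding num_def num'_def by (simp only: mult_ac)
      \<comment> \<open>Duality exchanges the two groups of products in \<open>t\<close>, and in
        \<open>D\<close> it exchanges the products of \<open>b, c, d\<close> with \<open>z\<close>
        and the pair products with \<open>G\<close>, while \<open>a * z * G\<close> is its own
        dual.\<close>
      note cross = cross_multiplied_eq[OF nonzero this,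
         where K = "b * c * d * exp (lz * (2 - (la + lb + lc + ld) / L)) * exp (g * (la - lz))" and
         t = "qpoch_inf q (Q * z / b) * qpoch_inf q (Q * z / c) * qpoch_inf q (Q * z / d) *
           (qpoch_inf q (a * b * G) * qpoch_inf q (a * c * G) * qpoch_inf q (a * d * G))" and
         D = "qpoch_inf q (b * z) * qpoch_inf q (c * z) * qpoch_inf q (d * z) *
           (qpoch_inf q (b * c * G) * qpoch_inf q (b * d * G) * qpoch_inf q (c * d * G) * qpoch_inf q (a * z * G))"]
      \<comment> \<open>By \<open>BC\<close> these are the pair products \<open>C * D\<close>,
        \<open>B * D\<close>, \<open>B * C\<close> in the dual normalization.\<close>
      have bx: "b / z * x = Q * b / a" "c / z * x = Q * c / a" "d / z * x = Q * d / a"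
        using nz by (simp_all add: x_def)
      show ?thesis
        using cross unfolding E1(1) E2(1) pw unfolding num_def num'_def ABCD QZ AB AZH BH BZ BCDHZ BZ' bx
        unfolding BC x_def e_def by (simp only: mult_ac)
    qed
  qed
qed

end
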